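(* Let $\mu_n$ be the critical Curie--Weiss measure on $\Omega_n=\{\pm1\}^n$ (inverse temperature $\beta=1$, external field $h=0$), and for $\sigma\in\Omega_n$ let $S_n=\sigma_1+\cdots+\sigma_n$ and $W_n=S_n/n^{3/4}$. Let $$p_1(t)=e^{-t^4/12},\qquad p_2(t)=\left(\frac{t^2}{2}-\frac{t^6}{30}\right)e^{-t^4/12},$$ $$F(x)=\frac{\int_{-\infty}^{x}p_1(t)\,dt}{\int_{-\infty}^{\infty}p_1(t)\,dt},\qquad G(x)=\frac{\int_x^{\infty}p_2(t)\,dt}{\int_x^{\infty}p_1(t)\,dt}-\frac{\int_{-\infty}^{\infty}p_2(t)\,dt}{\int_{-\infty}^{\infty}p_1(t)\,dt}.$$ Then for $0\le x\le n^{1/12}$, $$\frac{\mu_n(\sigma: W_n>x)}{1-F(x)}=1+O(1)\frac{1+x^6}{\sqrt n},$$ that is, there exists a constant $C>0$ such that for all integers $n\ge1$ and all real $x$ with $0\le x\le n^{1/12}$, $$\left|\frac{\mu_n(\sigma: W_n>x)}{1-F(x)}-1\right|\le \frac{C(1+x^6)}{\sqrt n}.$$ Moreover, for any fixed real number $x$, $$\lim_{n\to\infty}\sqrt n\,\bigl(\mu_n(\sigma: W_n\le x)-F(x)\bigr)=(F(x)-1)\,G(x).$$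
   Context: The Curie--Weiss model with inverse temperature $\beta>0$ and external field $h\in\mathbb{R}$ is the probability measure on $\Omega_n=\{\pm1\}^n$ given by $$\mu_n(\sigma)=Z_n^{-1}\exp\left(\frac{\beta}{n}\sum_{1\le i<j\le n}\sigma_i\sigma_j+\beta h\sum_{i=1}^n\sigma_i\right),\qquad \sigma\in\Omega_n,$$ where $Z_n$ is the normalizing constant. In the critical case $\beta=1$, $h=0$ this is $\mu_n(\sigma)=Z_n^{-1}\exp\left(\frac1n\sum_{1\le i<j\le n}\sigma_i\sigma_j\right)$. *)

theory Defs
  imports "HOL-Probability.Probability"
begin

definition configs :: "nat \<Rightarrow> (nat \<Rightarrow> real) set" where
  "configs n = {1..n} \<rightarrow>\<^sub>E {-1, 1}"

definition cw_weight :: "real \<Rightarrow> real \<Rightarrow> nat \<Rightarrow> (nat \<Rightarrow> real) \<Rightarrow> real" where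
  "cw_weight \<beta> h n \<sigma> =
     exp (\<beta> / real n * (\<Sum>(i, j) \<in> {(i, j). 1 \<le> i \<and> i < j \<and> j \<le> n}. \<sigma> i * \<sigma> j)
          + \<beta> * h * (\<Sum>i = 1..n. \<sigma> i))"

definition cw_partition :: "real \<Rightarrow> real \<Rightarrow> nat \<Rightarrow> real" where
  "cw_partition \<beta> h n = (\<Sum>\<sigma> \<in> configs n. cw_weight \<beta> h n \<sigma>)"

definition curie_weiss :: "real \<Rightarrow> real \<Rightarrow> nat \<Rightarrow> (nat \<Rightarrow> real) measure" where
  "curie_weiss \<beta> h n =
     point_measure (configs n) (\<lambda>\<sigma>. ennreal (cw_weight \<beta> h n \<sigma> / cw_partition \<beta> h n))"

abbreviation critical_curie_weiss :: "nat \<Rightarrow> (nat \<Rightarrow> real) measure" where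
  "critical_curie_weiss n \<equiv> curie_weiss 1 0 n"

lemma finite_configs: "finite (configs n)"
  unfolding configs_def by (intro finite_PiE) auto

lemma cw_partition_pos: "cw_partition \<beta> h n > 0"
proof -
  have "configs n \<noteq> {}" by (simp add: configs_def PiE_eq_empty_iff)
  then show ?thesis
    unfolding cw_partition_def by (intro sum_pos finite_configs) (auto simp: cw_weight_def)
qed

lemma prob_space_curie_weiss: "prob_space (curie_weiss \<beta> h n)"
proof
  have "emeasure (curie_weiss \<beta> h n) (space (curie_weiss \<beta> h n)) =
        (\<Sum>\<sigma> \<in> configs n. ennreal (cw_weight \<beta> h n \<sigma> / cw_partition \<beta> h n))"
    unfolding curie_weiss_def by (simp add: space_point_measure emeasure_point_measure_finite finite_configs)
  also have "\<dots> = ennreal (\<Sum>\<sigma> \<in> configs n. cw_weight \<beta> h n \<sigma> / cw_partition \<beta> h n)"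
    using cw_partition_pos by (intro sum_ennreal) (auto simp: cw_weight_def intro: less_imp_le)
  also have "\<dots> = 1"
    using cw_partition_pos[of \<beta> h n]
    by (simp add: sum_divide_distrib[symmetric] cw_partition_def[symmetric])
  finally show "emeasure (curie_weiss \<beta> h n) (space (curie_weiss \<beta> h n)) = 1" .
qed

definition magnetization :: "nat \<Rightarrow> (nat \<Rightarrow> real) \<Rightarrow> real" where
  "magnetization n \<sigma> = (\<Sum>i = 1..n. \<sigma> i)"

definition scaled_magnetization :: "nat \<Rightarrow> (nat \<Rightarrow> real) \<Rightarrow> real" where
  "scaled_magnetization n \<sigma> = magnetization n \<sigma> / real n powr (3/4)"

definition p1 :: "real \<Rightarrow> real" where
  "p1 t = exp (- (t ^ 4) / 12)"

definition p2 :: "real \<Rightarrow> real" where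
  "p2 t = (t\<^sup>2 / 2 - t ^ 6 / 30) * exp (- (t ^ 4) / 12)"

definition F :: "real \<Rightarrow> real" where
  "F x = (LBINT t:{..x}. p1 t) / (LBINT t. p1 t)"

definition G :: "real \<Rightarrow> real" where
  "G x = (LBINT t:{x..}. p2 t) / (LBINT t:{x..}. p1 t) - (LBINT t. p2 t) / (LBINT t. p1 t)"

end

theory Submission
  imports Defs "HOL-Real_Asymp.Real_Asymp"
begin

text \<open>
  Grouping configurations by their number \<open>k\<close> of plus spins, the law of the magnetization
  \<open>m = 2 k - n\<close> has weights proportional to \<open>(n choose k) exp (m^2 / (2 n))\<close>. At the critical
  temperature the energy cancels the Gaussian decay of the binomial coefficient exactly, and the
  next term of its large deviation rate, of fourth order, governs the limit: at
  \<open>m = t n^(3/4)\<close> the weight, divided by the central weight, is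
  \<open>exp (- t^4/12 + (t^2/2 - t^6/30) / sqrt n + O(1/n))\<close>, which is \<open>p1 t + p2 t / sqrt n\<close> to first
  order.

  No form of Stirling's formula is needed for this, because only ratios of weights matter. Between
  the magnetizations \<open>j - 1\<close> and \<open>j + 1\<close> the weight changes by the factor
  \<open>(1 - y) / (1 + y) * exp (2 j / n)\<close> with \<open>y = j / (n + 1)\<close>. The logarithm of the fraction is
  \<open>- 2 y - 2 y^3 / 3 - 2 y^5 / 5 - \<dots>\<close>; the cubic term sums to \<open>- t^4/12\<close>, the discrepancy between \<open>2 y\<close>
  and \<open>2 j / n\<close> to \<open>t^2 / (2 sqrt n)\<close>, and the fifth order term to \<open>- t^6 / (30 sqrt n)\<close>. Telescoping
  against the corresponding polynomial in \<open>m\<close> gives \<open>log_level_weight_bounds\<close>.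

  Sums of weights are integrals of a step function \<open>profile n\<close>, constant on the cells of width
  \<open>2 / n^(3/4)\<close> around the values of the scaled magnetization. Both claims follow from two facts on
  it. The first, \<open>profile_close_p1\<close>, is the bound
  \<open>\<bar>profile n t - p1 t\<bar> \<le> C (1 + t^6) / sqrt n * p1 t\<close> for \<^emph>\<open>all\<close> real \<open>t\<close>: from above, the
  exponent exceeds \<open>- t^4/12\<close> by at most a multiple of \<open>(1 + t^2) / sqrt n\<close>, which stays bounded on the
  whole support; from below, the bound is trivial as soon as \<open>t^6\<close> exceeds \<open>sqrt n\<close>. The second,
  \<open>profile_expansion\<close>, is the pointwise limit of \<open>sqrt n * (profile n t - p1 t)\<close>, which is \<open>p2 t\<close>.

  Integrating the first fact over \<open>[x, \<infinity>)\<close> and using that under \<open>p1\<close> the tail average of \<open>1 + t^6\<close> is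
  \<open>O(1 + x^6)\<close> gives the relative error. By dominated convergence the two facts together give the
  first-order terms of the tail and of the total mass, and hence of their quotient. Cells are cut at
  their ends, not at \<open>x\<close>; moving \<open>x\<close> to the end of a cell costs \<open>O(n^(-3/4))\<close>, which is below the
  order \<open>n^(-1/2)\<close> of interest.
\<close>

section \<open>Ratios of consecutive weights\<close>

text \<open>
  Twice the sum of \<open>\<sigma> i * \<sigma> j\<close> over pairs is \<open>m^2 - n\<close>, so this is the total weight of the
  configurations with \<open>k\<close> plus spins up to the constant factor \<open>exp (- 1/2)\<close>.
\<close>

definition level_weight :: "nat \<Rightarrow> nat \<Rightarrow> real" where
  "level_weight n k = real (n choose k) * exp ((2 * real k - real n)\<^sup>2 / (2 * real n))"

text \<open>
  The derivative of the remainder \<open>f\<close> is \<open>- 2 y^6 / (1 - y^2)\<close>, so that \<open>f\<close> decreases, while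
  \<open>f + 2 y^7\<close> increases as long as \<open>y^2 \<le> 9/16\<close>.
\<close>

lemma ln_ratio_taylor:
  fixes y :: real
  assumes "0 \<le> y" "y < 1"
  defines "f \<equiv> ln ((1 - y) / (1 + y)) + 2 * y + 2/3 * y^3 + 2/5 * y^5"
  shows "f \<le> 0" and "y \<le> 3/4 \<Longrightarrow> - 2 * y^7 \<le> f"
proof -
  \<comment> \<open>The same function with the logarithm of the quotient split, which is easier to differentiate.\<close>
  define h where "h = (\<lambda>y::real. ln (1 - y) - ln (1 + y) + 2 * y + 2/3 * y^3 + 2/5 * y^5)"
  have f: "f = h y" using assms by (simp add: h_def ln_div)
  have D: "(h has_real_derivative (- 2 * z^6 / (1 - z\<^sup>2))) (at z)" if "0 \<le> z" "z < 1" for z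
  proof -
    have nz: "1 - z \<noteq> 0" "1 + z \<noteq> 0" "1 - z\<^sup>2 \<noteq> 0"
      using that by (auto simp: power2_eq_1_iff)
    have "- 1 / (1 - z) - 1 / (1 + z) + 2 + 2 * z\<^sup>2 + 2 * z^4 = - 2 * z^6 / (1 - z\<^sup>2)"
      using nz by (simp add: divide_simps) algebra
    moreover have "(h has_real_derivative (- 1 / (1 - z) - 1 / (1 + z) + 2 + 2 * z\<^sup>2 + 2 * z^4)) (at z)"
      unfolding h_def using that
      by (auto intro!: derivative_eq_intros simp del: minus_divide_left)
    ultimately show ?thesis by simp
  qed
  have "h y \<le> h 0"
  proof (rule DERIV_nonpos_imp_nonincreasing[OF assms(1)])
    fix z assume z: "0 \<le> z" "z \<le> y"
    then have "z\<^sup>2 < 1" using assms by (simp add: power_less_one_iff abs_square_less_1)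
    then have "- 2 * z^6 / (1 - z\<^sup>2) \<le> 0" by (simp add: divide_nonneg_pos)
    then show "\<exists>d. (h has_real_derivative d) (at z) \<and> d \<le> 0"
      using D[of z] z assms by auto
  qed
  then show "f \<le> 0" by (simp add: f h_def)
  assume y: "y \<le> 3/4"
  have "h 0 + 2 * 0^7 \<le> h y + 2 * y^7"
  proof (rule DERIV_nonneg_imp_nondecreasing[OF assms(1)])
    fix z :: real assume z: "0 \<le> z" "z \<le> y"
    then have "z\<^sup>2 \<le> (3/4)\<^sup>2" using y by (intro power_mono) auto
    then have z2: "z\<^sup>2 \<le> 9/16" by (simp add: power2_eq_square)
    then have "2 / (1 - z\<^sup>2) \<le> 14"
      by (simp add: pos_divide_le_eq)
    then have "z^6 * (2 / (1 - z\<^sup>2)) \<le> z^6 * 14" by (intro mult_left_mono) auto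
    then have "0 \<le> - 2 * z^6 / (1 - z\<^sup>2) + 14 * z^6" by (simp add: field_simps)
    moreover have "((\<lambda>z. h z + 2 * z^7) has_real_derivative (- 2 * z^6 / (1 - z\<^sup>2) + 14 * z^6)) (at z)"
      using z y by (auto intro!: derivative_eq_intros D)
    ultimately show "\<exists>d. ((\<lambda>z. h z + 2 * z^7) has_real_derivative d) (at z) \<and> d \<ge> 0" by blast
  qed
  then show "- 2 * y^7 \<le> f" by (simp add: f h_def)
qed

lemma power_diff_le:
  fixes a b :: real
  assumes "0 \<le> a" "a \<le> b"
  shows "b ^ Suc k - a ^ Suc k \<le> real (Suc k) * (b - a) * b ^ k"
proof (induction k)
  case (Suc k)
  have "b ^ Suc (Suc k) - a ^ Suc (Suc k) = b * (b ^ Suc k - a ^ Suc k) + (b - a) * a ^ Suc k"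
    by (simp add: algebra_simps)
  also have "\<dots> \<le> b * (real (Suc k) * (b - a) * b ^ k) + (b - a) * b ^ Suc k"
    using assms Suc by (intro add_mono mult_left_mono power_mono) auto
  also have "\<dots> = real (Suc (Suc k)) * (b - a) * b ^ Suc k" by (simp add: algebra_simps)
  finally show ?case .
qed auto

text \<open>
  Here \<open>j\<close> is the midpoint of two neighbouring magnetizations \<open>j - 1\<close> and \<open>j + 1\<close>. The first bound
  uses only the sign of the Taylor remainder and therefore holds up to \<open>j = n\<close>; the second one
  needs \<open>j / n\<close> to stay away from \<open>1\<close>. Its polynomial in \<open>j\<close> is \<open>T (j + 1) - T (j - 1)\<close> for
  \<open>T x = x^2 / (2 n^2) - x^4 / (12 n^3) - x^6 / (30 n^5)\<close>, so it can be summed exactly.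
\<close>

lemma step_bounds:
  fixes n j :: real
  assumes n: "1 \<le> n" and j: "0 \<le> j" "j \<le> n"
  defines "e \<equiv> ln ((n + 1 - j) / (n + 1 + j)) + 2 * j / n"
  shows "e \<le> 4 * j / n\<^sup>2 - 2/3 * j^3 / n^3"
    and "j \<le> 3/4 * n \<Longrightarrow>
      \<bar>e - (2 * j / n\<^sup>2 - 2/3 * (j^3 + j) / n^3 - (12 * j^5 + 40 * j^3 + 12 * j) / (30 * n^5))\<bar>
        \<le> 4 * j / n^3 + 6 * j^3 / n^4 + 2 * j^7 / n^7"
proof -
  define y where "y = j / (n + 1)"
  define v where "v = j / n"
  define f where "f = ln ((1 - y) / (1 + y)) + 2 * y + 2/3 * y^3 + 2/5 * y^5"
  have y: "0 \<le> y" "y < 1" and yv: "y \<le> v" and v: "0 \<le> v" "v \<le> 1"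
    using assms by (auto simp: y_def v_def field_simps)
  have "(1 - y) / (1 + y) = (n + 1 - j) / (n + 1 + j)"
    using assms by (simp add: y_def divide_simps)
  then have e: "e = f - 2 * y - 2/3 * y^3 - 2/5 * y^5 + 2 * v"
    by (simp add: e_def f_def v_def)
  have d2: "v - y = j / (n * (n + 1))" using n by (simp add: v_def y_def divide_simps algebra_simps)
  also have "\<dots> \<le> j / (n * n)" using n j by (intro divide_left_mono) auto
  finally have d: "v - y \<le> v / n" by (simp add: v_def)
  have d3: "v^3 - y^3 \<le> 3 * v^3 / n"
  proof -
    have "v^3 - y^3 \<le> 3 * (v - y) * v^2"
      using power_diff_le[of y v 2] y yv by (simp add: numeral_eq_Suc)
    also have "\<dots> \<le> 3 * (v / n) * v^2" using d v yv n by (intro mult_mono) auto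
    finally show ?thesis by (simp add: power3_eq_cube power2_eq_square)
  qed
  have d5: "v^5 - y^5 \<le> 5 * v^3 / n"
  proof -
    have "v^5 - y^5 \<le> 5 * (v - y) * v^4"
      using power_diff_le[of y v 4] y yv by (simp add: numeral_eq_Suc)
    also have "\<dots> \<le> 5 * (v / n) * v^2" using d v yv n by (intro mult_mono power_decreasing) auto
    finally show ?thesis by (simp add: power3_eq_cube power2_eq_square)
  qed
  have p3: "0 \<le> v^3 - y^3" and p5: "0 \<le> v^5 - y^5" using yv y by (auto intro: power_mono)
  have f0: "f \<le> 0" using ln_ratio_taylor(1)[OF y] by (simp add: f_def)
  have dd: "v - y \<le> j / n\<^sup>2" 
    unfolding d2 using assms by (intro divide_left_mono) (auto simp: power2_eq_square)
  have "v^3 / n \<le> v / n" using v n power_decreasing[of 1 3 v] by (intro divide_right_mono) auto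
  then have vn: "v^3 / n \<le> j / n\<^sup>2" by (simp add: v_def power2_eq_square)
  have "e \<le> 2 * (v - y) - 2/3 * y^3" unfolding e using f0 zero_le_power[OF y(1), of 5] by argo
  also have "\<dots> \<le> 2 * (j / n\<^sup>2) + 2/3 * (3 * v^3 / n) - 2/3 * v^3" using dd d3 by argo
  also have "\<dots> \<le> 4 * (j / n\<^sup>2) - 2/3 * v^3" using vn by argo
  finally show "e \<le> 4 * j / n\<^sup>2 - 2/3 * j^3 / n^3" by (simp add: v_def power_divide)
  assume "j \<le> 3/4 * n"
  then have "y \<le> 3/4" using assms by (simp add: y_def field_simps)
  then have "- 2 * y^7 \<le> f" using ln_ratio_taylor(2)[OF y] by (simp add: f_def)
  moreover have "y^7 \<le> v^7" using yv y by (intro power_mono) auto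
  ultimately have f1: "- 2 * v^7 \<le> f" by linarith
  have s1: "v - y - j / n\<^sup>2 \<ge> - j / n^3"
  proof -
    have "v - y - j / n\<^sup>2 = - j / (n\<^sup>2 * (n + 1))"
      unfolding d2 using n by (simp add: divide_simps power2_eq_square) algebra
    also have "\<dots> \<ge> - j / (n\<^sup>2 * n)" using assms by (intro divide_left_mono_neg) auto
    finally show ?thesis by (simp add: power3_eq_cube power2_eq_square)
  qed
  have s2: "j / n^5 \<le> j / n^3" using assms by (intro divide_left_mono power_increasing) auto
  have s3: "j^3 / n^5 \<le> j^3 / n^4" using assms by (intro divide_left_mono power_increasing) auto
  have s4: "v^3 / n = j^3 / n^4" "v^7 = j^7 / n^7" "v^3 = j^3/n^3" "v^5 = j^5/n^5"
    by (simp_all add: v_def power_divide numeral_eq_Suc)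
  have s5: "0 \<le> j / n^3" "0 \<le> j / n^5" "0 \<le> j^3/n^5" "0 \<le> j^3/n^4" "0 \<le> j^7/n^7" using assms by auto
  have "e - (2 * j / n\<^sup>2 - 2/3 * (j^3 + j) / n^3 - (12 * j^5 + 40 * j^3 + 12 * j) / (30 * n^5)) =
     f + 2 * (v - y - j / n\<^sup>2) + 2/3 * (v^3 - y^3) + 2/5 * (v^5 - y^5) + 2/3 * (j / n^3)
       + 4/3 * (j^3 / n^5) + 2/5 * (j / n^5)"
    unfolding e s4 by (simp add: add_divide_distrib algebra_simps)
  moreover have "v^3 - y^3 \<le> 3 * (j^3 / n^4)" "v^5 - y^5 \<le> 5 * (j^3 / n^4)"
    using d3 d5 unfolding s4(1)[symmetric] by simp_all
  moreover have "- 2 * (j^7 / n^7) \<le> f" using f1 unfolding s4 .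
  ultimately have "\<bar>e - (2 * j / n\<^sup>2 - 2/3 * (j^3 + j) / n^3 - (12 * j^5 + 40 * j^3 + 12 * j) / (30 * n^5))\<bar>
        \<le> 4 * (j / n^3) + 6 * (j^3 / n^4) + 2 * (j^7 / n^7)"
    using f0 s1 s2 s3 s5 dd p3 p5 unfolding abs_le_iff by argo
  then show "\<bar>e - (2 * j / n\<^sup>2 - 2/3 * (j^3 + j) / n^3 - (12 * j^5 + 40 * j^3 + 12 * j) / (30 * n^5))\<bar>
        \<le> 4 * j / n^3 + 6 * j^3 / n^4 + 2 * j^7 / n^7" by simp
qed

lemma level_weight_pos: "k \<le> n \<Longrightarrow> 0 < level_weight n k"
  by (simp add: level_weight_def)

lemma level_weight_symmetric: "k \<le> n \<Longrightarrow> level_weight n (n - k) = level_weight n k"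
proof -
  assume k: "k \<le> n"
  have "(2 * real (n - k) - real n)\<^sup>2 = (2 * real k - real n)\<^sup>2"
    using k by (simp add: of_nat_diff power2_eq_square algebra_simps)
  then show ?thesis using k by (simp add: level_weight_def binomial_symmetric[symmetric])
qed

text \<open>
  With \<open>y = j / (n + 1)\<close> the quotient of binomial coefficients is \<open>(1 - y) / (1 + y)\<close>: in terms of
  the midpoint \<open>j\<close> the increment is an odd function, and no terms of even order have to be tracked.
\<close>

lemma ln_level_weight_step:
  assumes "k < n"
  defines "j \<equiv> 2 * real k + 1 - real n"
  shows "ln (level_weight n (Suc k)) - ln (level_weight n k)
    = ln ((real n + 1 - j) / (real n + 1 + j)) + 2 * j / real n"
proof -
  have "real (Suc k) * real (n choose Suc k) = real (n - k) * real (n choose k)"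
    by (metis binomial_absorb_comp binomial_absorption mult.commute of_nat_mult)
  then have c: "real (n choose Suc k) = (real n + 1 - j) / (real n + 1 + j) * real (n choose k)"
    using assms by (simp add: of_nat_diff field_simps)
  have pos: "0 < (real n + 1 - j) / (real n + 1 + j)" using assms by simp
  have "ln (level_weight n (Suc k)) = ln ((real n + 1 - j) / (real n + 1 + j)) + ln (real (n choose k))
      + (2 * real (Suc k) - real n)\<^sup>2 / (2 * real n)"
    unfolding level_weight_def c using pos assms by (simp only: ln_mult_pos ln_exp mult_pos_pos exp_gt_zero of_nat_0_less_iff zero_less_binomial less_imp_le)
  moreover have "ln (level_weight n k) = ln (real (n choose k)) + (2 * real k - real n)\<^sup>2 / (2 * real n)"
    using assms by (simp add: level_weight_def ln_mult_pos)
  moreover have "(2 * real (Suc k) - real n)\<^sup>2 / (2 * real n) - (2 * real k - real n)\<^sup>2 / (2 * real n) = 2 * j / real n"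
    using assms by (simp add: field_simps power2_eq_square)
  ultimately show ?thesis by simp
qed

text \<open>
  Telescoping from the centre. The errors of \<open>step_bounds\<close> are dominated by increments of even
  powers, since \<open>(j + 1)^(p + 1) - (j - 1)^(p + 1) \<ge> 2 (p + 1) j^p\<close> for odd \<open>p\<close>; their sum is thus
  again an explicit polynomial. For odd \<open>n\<close> the walk starts at \<open>m = 1\<close> rather than at \<open>0\<close>, which
  accounts for the term \<open>1 / n\<close>.
\<close>

lemma log_level_weight_bounds:
  assumes n: "1 \<le> n" and k: "(n + 1) div 2 \<le> k" "k \<le> n"
  defines "m \<equiv> 2 * real k - real n"
  defines "D \<equiv> ln (level_weight n k / level_weight n ((n + 1) div 2))"
  shows "D \<le> 2 * m\<^sup>2 / real n ^ 2 - m^4 / (12 * real n ^ 3)"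
    and "m \<le> 3/4 * real n \<Longrightarrow>
      \<bar>D - (m\<^sup>2 / (2 * real n ^ 2) - m^4 / (12 * real n ^ 3) - m^6 / (30 * real n ^ 5))\<bar>
        \<le> 1 / real n + m\<^sup>2 / real n ^ 3 + m^4 / real n ^ 4 + m^8 / real n ^ 7"
proof -
  define k0 where "k0 = (n + 1) div 2"
  define M where "M = (\<lambda>i. 2 * real i - real n)"
  define L where "L = (\<lambda>i. ln (level_weight n i) - ln (level_weight n k0))"
  have D: "D = L k"
    using k level_weight_pos[of k n] level_weight_pos[of k0 n] by (simp add: D_def L_def k0_def ln_div)
  have M0: "M k0 = 0 \<or> M k0 = 1"
    by (cases "even n") (auto simp: M_def k0_def elim!: evenE oddE)
  have L0: "L k0 = 0" by (simp add: L_def)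
  have incr: "M (Suc i) = (M i + 1) + 1" "M i = (M i + 1) - 1" "0 \<le> M i + 1" "M i + 1 \<le> n"
    "L (Suc i) - L i = ln ((real n + 1 - (M i + 1)) / (real n + 1 + (M i + 1))) + 2 * (M i + 1) / real n"
    if "k0 \<le> i" "i < n" for i
  proof -
    have "n \<le> 2 * k0" by (auto simp: k0_def)
    then have "real n \<le> 2 * real i" using that by linarith
    then show "0 \<le> M i + 1" by (simp add: M_def)
    have "real i + 1 \<le> real n" using that by linarith
    then show "M i + 1 \<le> n" by (simp add: M_def)
    show "L (Suc i) - L i = ln ((real n + 1 - (M i + 1)) / (real n + 1 + (M i + 1))) + 2 * (M i + 1) / real n"
      using ln_level_weight_step[OF that(2)] by (simp add: L_def M_def algebra_simps)
  qed (simp_all add: M_def)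
  have n1: "1 \<le> real n" using n by simp
  \<comment> \<open>The increments of \<open>U\<close> dominate the first bound of \<open>step_bounds\<close>.\<close>
  define U where "U = (\<lambda>x::real. 2 * x\<^sup>2 / real n ^ 2 - x^4 / (12 * real n ^ 3))"
  have "L k \<le> U (M k) - U (M k0)" using k(1)[folded k0_def] k(2)
  proof (induction rule: dec_induct)
    case (step i)
    then have i: "k0 \<le> i" "i < n" by auto
    define j where "j = M i + 1"
    note s = incr[OF i]
    have "U (j + 1) - U (j - 1) = 8 * j / real n ^ 2 - 2/3 * j ^ 3 / real n ^ 3 - 2/3 * j / real n ^ 3"
      unfolding U_def using n1 by (simp add: field_simps) algebra
    moreover have "j / real n ^ 3 \<le> j / real n ^ 2"
      using n1 s unfolding j_def by (intro divide_left_mono power_increasing) auto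
    moreover have "0 \<le> j / real n ^ 2" using s by (simp add: j_def)
    moreover have "L (Suc i) - L i \<le> 4 * j / real n ^ 2 - 2/3 * j^3 / real n ^ 3"
      using step_bounds(1)[OF n1 s(3,4)] s(5) by (simp add: j_def)
    ultimately have "L (Suc i) - L i \<le> U (j + 1) - U (j - 1)" by argo
    moreover have "M (Suc i) = j + 1" "M i = j - 1" by (simp_all add: j_def s(1))
    ultimately show ?case using step by simp
  qed (simp add: L0)
  moreover have "0 \<le> U (M k0)"
  proof -
    have "1 / (12 * real n ^ 3) \<le> 2 / real n ^ 2" using n1 by (simp add: field_simps numeral_eq_Suc)
    then show ?thesis using M0 by (auto simp: U_def)
  qed
  ultimately show "D \<le> 2 * m\<^sup>2 / real n ^ 2 - m^4 / (12 * real n ^ 3)"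
    unfolding D m_def by (simp add: U_def M_def)
  assume m: "m \<le> 3/4 * real n"
  define T where "T = (\<lambda>x::real. x\<^sup>2 / (2 * real n ^ 2) - x^4 / (12 * real n ^ 3) - x^6 / (30 * real n ^ 5))"
  \<comment> \<open>The increments of \<open>B\<close> dominate the error of the second bound of \<open>step_bounds\<close>.\<close>
  define B where "B = (\<lambda>x::real. x\<^sup>2 / real n ^ 3 + x^4 / real n ^ 4 + x^8 / real n ^ 7)"
  have "\<bar>L k - (T (M k) - T (M k0))\<bar> \<le> B (M k) - B (M k0)" using k(1)[folded k0_def]
  proof (induction rule: dec_induct)
    case (step i)
    then have i: "k0 \<le> i" "i < n" using k by auto
    define j where "j = M i + 1"
    note s = incr[OF i]
    have "real i + 1 \<le> real k" using step by linarith
    then have j: "0 \<le> j" "j \<le> 3/4 * n" using s m by (auto simp: j_def M_def m_def)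
    have "T (j + 1) - T (j - 1) = 2 * j / real n ^ 2 - 2/3 * (j^3 + j) / real n ^ 3 - (12 * j^5 + 40 * j^3 + 12 * j) / (30 * real n ^ 5)"
      unfolding T_def using n1 by (simp add: field_simps) algebra
    then have "\<bar>L (Suc i) - L i - (T (j + 1) - T (j - 1))\<bar> \<le> 4 * j / real n ^ 3 + 6 * j^3 / real n ^ 4 + 2 * j^7 / real n ^ 7"
      using step_bounds(2)[OF n1 s(3,4)] j s(5) by (simp add: j_def)
    also have "\<dots> \<le> B (j + 1) - B (j - 1)"
    proof -
      have "B (j + 1) - B (j - 1) = 4 * j / real n ^ 3 + 8 * (j^3 + j) / real n ^ 4 + (16 * j^7 + 112 * j^5 + 112 * j^3 + 16 * j) / real n ^ 7"
        unfolding B_def using n1 by (simp add: field_simps) algebra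
      moreover have "6 * j^3 / real n ^ 4 \<le> 8 * (j^3 + j) / real n ^ 4" using j by (intro divide_right_mono) auto
      moreover have "2 * j^7 / real n ^ 7 \<le> (16 * j^7 + 112 * j^5 + 112 * j^3 + 16 * j) / real n ^ 7"
      proof (intro divide_right_mono)
        have "0 \<le> j^7" "0 \<le> j^5" "0 \<le> j^3" using j by auto
        then show "2 * j^7 \<le> 16 * j^7 + 112 * j^5 + 112 * j^3 + 16 * j" using j(1) by linarith
      qed auto
      ultimately show ?thesis by linarith
    qed
    finally have "\<bar>L (Suc i) - L i - (T (j + 1) - T (j - 1))\<bar> \<le> B (j + 1) - B (j - 1)" .
    moreover have "M (Suc i) = j + 1" "M i = j - 1" by (simp_all add: j_def s(1))
    ultimately show ?case using step.IH by (simp add: abs_le_iff)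
  qed (simp add: L0)
  moreover have "0 \<le> B (M k0)" by (simp add: B_def)
  moreover have "\<bar>T (M k0)\<bar> \<le> 1 / real n"
  proof -
    have "1 / real n ^ 2 \<le> 1 / real n ^ 1" "1 / real n ^ 3 \<le> 1 / real n ^ 1" "1 / real n ^ 5 \<le> 1 / real n ^ 1"
      using n1 by (intro divide_left_mono power_increasing; simp)+
    moreover have "0 \<le> 1 / real n ^ 2" "0 \<le> 1 / real n ^ 3" "0 \<le> 1 / real n ^ 5" by auto
    ultimately have "\<bar>1/2 * (1 / real n ^ 2) - 1/12 * (1 / real n ^ 3) - 1/30 * (1 / real n ^ 5)\<bar> \<le> 1 / real n"
      unfolding power_one_right by argo
    then show ?thesis using M0 by (auto simp: T_def)
  qed
  ultimately have "\<bar>L k - T (M k)\<bar> \<le> 1 / real n + B (M k)" by argo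
  then show "\<bar>D - (m\<^sup>2 / (2 * real n ^ 2) - m^4 / (12 * real n ^ 3) - m^6 / (30 * real n ^ 5))\<bar>
        \<le> 1 / real n + m\<^sup>2 / real n ^ 3 + m^4 / real n ^ 4 + m^8 / real n ^ 7"
    unfolding D m_def by (simp add: T_def B_def M_def)
qed

section \<open>Weights on the critical scale\<close>

text \<open>
  The three scales \<open>n^(3/4)\<close> of the magnetization, \<open>sqrt n\<close> of the correction and \<open>n\<close> are powers of
  \<open>n^(1/4)\<close> with natural exponents, so that estimates become inequalities between polynomials.
\<close>

definition rt :: "nat \<Rightarrow> real" where "rt n = real n powr (1/4)"

lemma rt_powers:
  assumes "1 \<le> n"
  shows "1 \<le> rt n" "real n = rt n ^ 4" "sqrt (real n) = (rt n)\<^sup>2" "real n powr (3/4) = rt n ^ 3"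
proof -
  have n: "1 \<le> real n" using assms by simp
  show "1 \<le> rt n" unfolding rt_def using n by (simp add: ge_one_powr_ge_zero)
  show "real n = rt n ^ 4" using n by (simp add: rt_def powr_power)
  show "sqrt (real n) = (rt n)\<^sup>2" using n by (simp add: rt_def powr_power powr_half_sqrt)
  show "real n powr (3/4) = rt n ^ 3" using n by (simp add: rt_def powr_power)
qed

definition position :: "nat \<Rightarrow> nat \<Rightarrow> real" where
  "position n k = (2 * real k - real n) / rt n ^ 3"

text \<open>
  Dividing by the central weight fixes the normalization for which the limit is \<open>p1\<close>, as \<open>p1 0 = 1\<close>;
  the partition function cancels in all quotients considered.
\<close>

definition rel_weight :: "nat \<Rightarrow> nat \<Rightarrow> real" where
  "rel_weight n k = level_weight n k / level_weight n ((n + 1) div 2)"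

lemma rel_weight_pos: "k \<le> n \<Longrightarrow> 0 < rel_weight n k"
  unfolding rel_weight_def by (intro divide_pos_pos level_weight_pos) auto

lemma abs_position_le:
  assumes "1 \<le> n" "k \<le> n" shows "\<bar>position n k\<bar> \<le> rt n"
proof -
  have "\<bar>2 * real k - real n\<bar> \<le> rt n * rt n ^ 3"
    using assms rt_powers(2)[OF assms(1)] by (simp add: abs_le_iff numeral_eq_Suc algebra_simps)
  then show ?thesis using rt_powers(1)[OF assms(1)] by (simp add: position_def pos_divide_le_eq)
qed

text \<open>
  \<open>log_level_weight_bounds\<close> in the variable \<open>s = m / n^(3/4)\<close>. The weights are invariant under
  \<open>k \<mapsto> n - k\<close> and the bounds are even in \<open>s\<close>, which covers negative magnetizations.
\<close>

lemma ln_rel_weight_bounds: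
  assumes n: "1 \<le> n" and k: "k \<le> n"
  defines "s \<equiv> position n k" and "r \<equiv> rt n"
  shows "ln (rel_weight n k) \<le> 2 * s\<^sup>2 / r\<^sup>2 - s^4 / 12"
    and "\<bar>s\<bar> \<le> 3/4 * r \<Longrightarrow>
      \<bar>ln (rel_weight n k) + s^4 / 12 - (s\<^sup>2 / 2 - s^6 / 30) / r\<^sup>2\<bar> \<le> 4 * (1 + s^8) / r^4"
proof -
  have r: "1 \<le> r" "real n = r^4" using rt_powers[OF n] by (auto simp: r_def)
  have *: "ln (rel_weight n k) \<le> 2 * s\<^sup>2 / r\<^sup>2 - s^4 / 12 \<and>
      (\<bar>s\<bar> \<le> 3/4 * r \<longrightarrow>
        \<bar>ln (rel_weight n k) + s^4 / 12 - (s\<^sup>2 / 2 - s^6 / 30) / r\<^sup>2\<bar> \<le> 4 * (1 + s^8) / r^4)"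
    if k': "(n + 1) div 2 \<le> k" "k \<le> n" and s: "s = (2 * real k - real n) / r^3" for k s
  proof -
    define m where "m = 2 * real k - real n"
    have ms: "m = s * r^3" using r by (simp add: s m_def)
    have e: "(s * r^3)\<^sup>2 / (r^4)\<^sup>2 = s\<^sup>2 / r\<^sup>2" "(s * r^3)^4 / (r^4)^3 = s^4" "(s * r^3)^6 / (r^4)^5 = s^6 / r\<^sup>2"
      using r by (simp_all add: power_mult_distrib divide_simps flip: power_mult power_add)
    have e': "(s * r^3)\<^sup>2 / (r^4)^3 = s\<^sup>2 / r^6" "(s * r^3)^4 / (r^4)^4 = s^4 / r^4" "(s * r^3)^8 / (r^4)^7 = s^8 / r^4"
      using r by (simp_all add: power_mult_distrib divide_simps flip: power_mult power_add)
    note B = log_level_weight_bounds[OF n k', folded rel_weight_def m_def, unfolded ms r]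
    have "\<bar>ln (rel_weight n k) + s^4 / 12 - (s\<^sup>2 / 2 - s^6 / 30) / r\<^sup>2\<bar> \<le> 4 * (1 + s^8) / r^4"
      if sr: "\<bar>s\<bar> \<le> 3/4 * r"
    proof -
      have "s * r^3 \<le> 3/4 * r * r^3" using sr r by (intro mult_right_mono) auto
      then have "s * r^3 \<le> 3/4 * r^4" by (simp add: numeral_eq_Suc)
      note B(2)[OF this]
      also have "(s * r^3)\<^sup>2 / (2 * (r^4)\<^sup>2) - (s * r^3)^4 / (12 * (r^4)^3) - (s * r^3)^6 / (30 * (r^4)^5)
         = 1/2 * ((s * r^3)\<^sup>2 / (r^4)\<^sup>2) - 1/12 * ((s * r^3)^4 / (r^4)^3) - 1/30 * ((s * r^3)^6 / (r^4)^5)"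
        by simp
      also have "\<dots> = (s\<^sup>2 / 2 - s^6 / 30) / r\<^sup>2 - s^4 / 12"
        unfolding e by (simp add: diff_divide_distrib)
      also have "1 / r^4 + (s * r^3)\<^sup>2 / (r^4)^3 + (s * r^3)^4 / (r^4)^4 + (s * r^3)^8 / (r^4)^7
         = 1 / r^4 + s\<^sup>2 / r^6 + s^4 / r^4 + s^8 / r^4"
        unfolding e' ..
      also have "\<dots> \<le> (1 + s\<^sup>2 + s^4 + s^8) / r^4"
      proof -
        have "s\<^sup>2 / r^6 \<le> s\<^sup>2 / r^4" using r by (intro divide_left_mono power_increasing) auto
        then show ?thesis by (simp add: add_divide_distrib)
      qed
      also have "\<dots> \<le> 4 * (1 + s^8) / r^4"
      proof (intro divide_right_mono)
        have "0 \<le> (s^4 - 1)\<^sup>2" "0 \<le> (s^2 - 1)\<^sup>2" by auto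
        then have "2 * s^4 \<le> s^8 + 1" "2 * s^2 \<le> s^4 + 1" by (simp_all add: power2_diff flip: power_mult)
        moreover have "0 \<le> s^8" by simp
        ultimately have "1 + s\<^sup>2 + s^4 + s^8 \<le> 4 + 4 * s^8" by linarith
        then show "1 + s\<^sup>2 + s^4 + s^8 \<le> 4 * (1 + s^8)" by simp
      qed (use r in auto)
      finally show ?thesis by (simp add: algebra_simps)
    qed
    moreover have "2 * (s * r^3)\<^sup>2 / (r^4)\<^sup>2 - (s * r^3)^4 / (12 * (r^4)^3) = 2 * s\<^sup>2 / r\<^sup>2 - s^4 / 12"
    proof -
      have "2 * (s * r^3)\<^sup>2 / (r^4)\<^sup>2 - (s * r^3)^4 / (12 * (r^4)^3)
        = 2 * ((s * r^3)\<^sup>2 / (r^4)\<^sup>2) - 1/12 * ((s * r^3)^4 / (r^4)^3)" by simp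
      then show ?thesis unfolding e by simp
    qed
    ultimately show ?thesis using B(1) by (simp only:) blast
  qed
  have "ln (rel_weight n k) \<le> 2 * s\<^sup>2 / r\<^sup>2 - s^4 / 12 \<and>
      (\<bar>s\<bar> \<le> 3/4 * r \<longrightarrow>
        \<bar>ln (rel_weight n k) + s^4 / 12 - (s\<^sup>2 / 2 - s^6 / 30) / r\<^sup>2\<bar> \<le> 4 * (1 + s^8) / r^4)"
  proof (cases "(n + 1) div 2 \<le> k")
    case True
    then show ?thesis using *[of k s] k by (simp add: s_def position_def r_def)
  next
    case False
    then have nk: "(n + 1) div 2 \<le> n - k" "n - k \<le> n" by auto
    have "- s = (2 * real (n - k) - real n) / r^3"
      using k by (simp add: s_def position_def r_def of_nat_diff minus_divide_left)
    from *[OF nk this] show ?thesis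
      using k by (simp add: rel_weight_def level_weight_symmetric)
  qed
  then show "ln (rel_weight n k) \<le> 2 * s\<^sup>2 / r\<^sup>2 - s^4 / 12"
    and "\<bar>s\<bar> \<le> 3/4 * r \<Longrightarrow>
      \<bar>ln (rel_weight n k) + s^4 / 12 - (s\<^sup>2 / 2 - s^6 / 30) / r\<^sup>2\<bar> \<le> 4 * (1 + s^8) / r^4"
    by auto
qed

text \<open>
  The cost of replacing a lattice point \<open>s\<close> by another point \<open>t\<close> of its cell. It is
  \<open>O(r^(-3) * \<bar>t\<bar>^3)\<close>, and since \<open>\<bar>t\<bar> \<le> 2 r\<close> one factor of \<open>\<bar>t\<bar>\<close> can be traded for \<open>r\<close>.
\<close>

lemma position_near_bounds:
  fixes s t r :: real
  assumes r: "1 \<le> r" and s: "\<bar>s\<bar> \<le> r" and ts: "\<bar>t - s\<bar> \<le> 1 / r^3"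
  shows "\<bar>t^4 - s^4\<bar> \<le> 9 * (1 + t\<^sup>2) / r\<^sup>2" "s\<^sup>2 \<le> 2 * (1 + t\<^sup>2)" "t\<^sup>2 \<le> 4 * r\<^sup>2"
proof -
  have "1 / r^3 \<le> 1" using r by simp
  then have 1: "\<bar>s\<bar> \<le> \<bar>t\<bar> + 1" "\<bar>t\<bar> \<le> \<bar>s\<bar> + 1" using ts by auto
  have "s\<^sup>2 \<le> (\<bar>t\<bar> + 1)\<^sup>2" using 1 abs_le_square_iff by fastforce
  also have "\<dots> \<le> 2 * t\<^sup>2 + 2" using zero_le_power2[of "\<bar>t\<bar> - 1"] by (simp add: power2_eq_square algebra_simps)
  finally show s2: "s\<^sup>2 \<le> 2 * (1 + t\<^sup>2)" by simp
  have "t\<^sup>2 \<le> (2 * r)\<^sup>2" using 1 s r by (subst abs_le_square_iff[symmetric]) auto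
  then show "t\<^sup>2 \<le> 4 * r\<^sup>2" by (simp add: power_mult_distrib)
  have "t^4 - s^4 = (t - s) * ((t + s) * (t\<^sup>2 + s\<^sup>2))" by algebra
  then have "\<bar>t^4 - s^4\<bar> = \<bar>t - s\<bar> * (\<bar>t + s\<bar> * (t\<^sup>2 + s\<^sup>2))" by (simp add: abs_mult)
  also have "\<dots> \<le> (1 / r^3) * ((3 * r) * (3 * (1 + t\<^sup>2)))"
    using ts s2 1 s r by (intro mult_mono) auto
  also have "\<dots> = 9 * (1 + t\<^sup>2) / r\<^sup>2" using r by (simp add: power2_eq_square power3_eq_cube)
  finally show "\<bar>t^4 - s^4\<bar> \<le> 9 * (1 + t\<^sup>2) / r\<^sup>2" .
qed

lemma power2_le_power6: "(t::real)\<^sup>2 \<le> 1 + t^6"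
proof (cases "\<bar>t\<bar> \<le> 1")
  case True
  then show ?thesis by (simp add: abs_square_le_1 add_increasing2)
next
  case False
  then have "\<bar>t\<bar>^2 \<le> \<bar>t\<bar>^6" by (intro power_increasing) auto
  then show ?thesis by simp
qed

text \<open>
  Write the quotient of the weight and \<open>p1 t\<close> as \<open>exp \<psi>\<close>. From above, \<open>\<psi>\<close> is at most
  \<open>5 (1 + t^2) / r^2\<close>, hence at most \<open>25\<close> because \<open>t^2 \<le> 4 r^2\<close>, and \<open>exp \<psi> - 1\<close> is linear in \<open>\<psi>\<close> up to
  the factor \<open>exp 25\<close>. From below, \<open>exp \<psi> - 1 \<ge> \<psi>\<close> suffices where the sharp expansion holds, and
  elsewhere \<open>1 + t^6\<close> is at least of order \<open>r^2\<close>, so that the trivial bound \<open>- 1\<close> is enough.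
\<close>

lemma rel_weight_close_p1:
  assumes n: "1 \<le> n" and k: "k \<le> n" and t: "\<bar>t - position n k\<bar> \<le> 1 / rt n ^ 3"
  shows "\<bar>rel_weight n k - p1 t\<bar> \<le> 10 * exp 25 * (1 + t^6) / (rt n)\<^sup>2 * p1 t"
proof -
  define r s where "r = rt n" and "s = position n k"
  define \<psi> where "\<psi> = ln (rel_weight n k) + t^4 / 12"
  have r: "1 \<le> r" using rt_powers[OF n] by (simp add: r_def)
  have s: "\<bar>s\<bar> \<le> r" using abs_position_le[OF n k] by (simp add: r_def s_def)
  note near = position_near_bounds[OF r s t[folded r_def s_def]]
  note b = ln_rel_weight_bounds[OF n k, folded r_def s_def]
  have t6: "0 \<le> t^6" "0 \<le> s^6" by simp_all
  then have "1 + t\<^sup>2 \<le> 2 + 2 * t^6" using power2_le_power6[of t] by linarith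
  then have t26: "1 + t\<^sup>2 \<le> 2 * (1 + t^6)" by simp
  have e25: "26 \<le> exp (25::real)" using exp_ge_add_one_self[of 25] by simp
  have rho: "rel_weight n k = exp \<psi> * p1 t"
    using rel_weight_pos[OF k] by (simp add: \<psi>_def p1_def exp_add exp_minus)
  have up: "\<psi> \<le> 5 * (1 + t\<^sup>2) / r\<^sup>2"
  proof -
    have "\<psi> \<le> 2 * s\<^sup>2 / r\<^sup>2 + (t^4 - s^4) / 12" using b(1) by (simp add: \<psi>_def diff_divide_distrib)
    also have "\<dots> \<le> 2 * (2 * (1 + t\<^sup>2)) / r\<^sup>2 + (9 * (1 + t\<^sup>2) / r\<^sup>2) / 12"
      using near r by (intro add_mono divide_right_mono) auto
    also have "\<dots> = 19/4 * ((1 + t\<^sup>2) / r\<^sup>2)" using r by (simp add: divide_simps)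
    also have "\<dots> \<le> 5 * ((1 + t\<^sup>2) / r\<^sup>2)" by (intro mult_right_mono) auto
    finally show ?thesis by simp
  qed
  have "exp \<psi> - 1 \<le> 10 * exp 25 * (1 + t^6) / r\<^sup>2"
  proof (cases "\<psi> \<le> 0")
    case True
    then have "exp \<psi> - 1 \<le> 0" by simp
    also have "0 \<le> 10 * exp 25 * (1 + t^6) / r\<^sup>2" using t6 by (intro divide_nonneg_nonneg mult_nonneg_nonneg) auto
    finally show ?thesis .
  next
    case False
    have "5 * (1 + t\<^sup>2) / r\<^sup>2 \<le> 5 * (r\<^sup>2 + 4 * r\<^sup>2) / r\<^sup>2"
      using near(3) r by (intro divide_right_mono mult_left_mono add_mono) auto
    also have "\<dots> = 25" using r by simp
    finally have "\<psi> \<le> 25" using up by simp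
    have "1 - \<psi> \<le> exp (- \<psi>)" using exp_ge_add_one_self[of "- \<psi>"] by simp
    then have "exp \<psi> * (1 - \<psi>) \<le> exp \<psi> * exp (- \<psi>)" by (intro mult_left_mono) auto
    then have "exp \<psi> - 1 \<le> exp \<psi> * \<psi>" by (simp add: exp_minus algebra_simps)
    also have "\<dots> \<le> exp 25 * (5 * (1 + t\<^sup>2) / r\<^sup>2)"
      using up \<open>\<psi> \<le> 25\<close> False by (intro mult_mono) auto
    also have "\<dots> \<le> exp 25 * (5 * (2 * (1 + t^6)) / r\<^sup>2)"
      using t26 by (intro mult_left_mono divide_right_mono) auto
    finally show ?thesis by (simp add: algebra_simps)
  qed
  moreover have "- (200 * (1 + t^6) / r\<^sup>2) \<le> exp \<psi> - 1"
  proof (cases "\<bar>s\<bar> \<le> 3/4 * r")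
    case True
    have "s\<^sup>2 \<le> r\<^sup>2" using s r by (subst abs_le_square_iff[symmetric]) auto
    then have "s^6 * s\<^sup>2 / r^4 \<le> s^6 * r\<^sup>2 / r^4" by (intro divide_right_mono mult_left_mono) auto
    also have "\<dots> = s^6 / r\<^sup>2" using r by (simp add: divide_simps flip: power_add)
    finally have s8: "s^8 / r^4 \<le> s^6 / r\<^sup>2" by (simp flip: power_add)
    have r4: "1 / r^4 \<le> 1 / r\<^sup>2" using r by (intro divide_left_mono power_increasing) auto
    have s6: "s^6 \<le> 32 * (1 + t^6)"
    proof -
      have "(s\<^sup>2)^3 \<le> (2 * (1 + t\<^sup>2))^3" using near(2) by (intro power_mono) auto
      also have "\<dots> = 32 * (1 + t^6) - 24 * ((t\<^sup>2 - 1)\<^sup>2 * (t\<^sup>2 + 1))"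
        by (simp add: numeral_eq_Suc algebra_simps)
      also have "\<dots> \<le> 32 * (1 + t^6) - 0" by (intro diff_left_mono) simp
      finally show ?thesis by (simp flip: power_mult)
    qed
    have "- (4 * (1 + s^8) / r^4) \<le> ln (rel_weight n k) + s^4 / 12 - (s\<^sup>2 / 2 - s^6 / 30) / r\<^sup>2"
      using b(2)[OF True] by linarith
    moreover have "4 * (1 + s^8) / r^4 \<le> 4 * (1 / r\<^sup>2) + 4 * (s^6 / r\<^sup>2)" using s8 r4 by (simp add: add_divide_distrib)
    moreover have "(s\<^sup>2 / 2 - s^6 / 30) / r\<^sup>2 \<ge> - (s^6 / r\<^sup>2)"
      proof -
      have "- (s^6) / r\<^sup>2 \<le> (s\<^sup>2 / 2 - s^6 / 30) / r\<^sup>2"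
        using zero_le_power2[of s] t6 by (intro divide_right_mono) (linarith | simp)+
      then show ?thesis by simp
    qed
    moreover have "- (9 * (1 + t\<^sup>2) / r\<^sup>2) \<le> t^4 - s^4" using near(1) by linarith
    moreover have "9 * (1 + t\<^sup>2) / r\<^sup>2 \<le> 18 * ((1 + t^6) / r\<^sup>2)"
      using mult_left_mono[OF divide_right_mono[OF t26, of "r\<^sup>2"], of 9] by simp
    moreover have "s^6 / r\<^sup>2 \<le> 32 * ((1 + t^6) / r\<^sup>2)" using divide_right_mono[OF s6, of "r\<^sup>2"] by simp
    moreover have "1 / r\<^sup>2 \<le> (1 + t^6) / r\<^sup>2" by (intro divide_right_mono) auto
    moreover have "0 \<le> (1 + t^6) / r\<^sup>2" by simp
    ultimately have "- (200 * ((1 + t^6) / r\<^sup>2)) \<le> \<psi>" 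
      unfolding \<psi>_def by linarith
    moreover have "\<psi> \<le> exp \<psi> - 1" using exp_ge_add_one_self[of \<psi>] by linarith
    ultimately show ?thesis by simp
  next
    case False
    then have "(3/4 * r)\<^sup>2 \<le> s\<^sup>2" using r by (subst abs_le_square_iff[symmetric]) auto
    then have "9/16 * r\<^sup>2 \<le> s\<^sup>2" by (simp add: power_mult_distrib power_divide)
    moreover have "s\<^sup>2 \<le> 2 + 2 * t\<^sup>2" "1 + t\<^sup>2 \<le> 2 + 2 * t^6" using near(2) t26 by simp_all
    ultimately have "r\<^sup>2 \<le> 200 + 200 * t^6" using t6 by linarith
    then have "r\<^sup>2 \<le> 200 * (1 + t^6)" by simp
    then have "1 \<le> 200 * (1 + t^6) / r\<^sup>2" using r by (simp add: pos_le_divide_eq)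
    then show ?thesis using exp_gt_zero[of \<psi>] by linarith
  qed
  moreover have "200 * (1 + t^6) / r\<^sup>2 \<le> 10 * exp 25 * (1 + t^6) / r\<^sup>2"
    using e25 by (intro divide_right_mono mult_right_mono) auto
  ultimately have "\<bar>exp \<psi> - 1\<bar> \<le> 10 * exp 25 * (1 + t^6) / r\<^sup>2" by linarith
  then have "\<bar>exp \<psi> - 1\<bar> * p1 t \<le> 10 * exp 25 * (1 + t^6) / r\<^sup>2 * p1 t"
    by (intro mult_right_mono) (auto simp: p1_def)
  moreover have "rel_weight n k - p1 t = (exp \<psi> - 1) * p1 t" by (simp add: rho algebra_simps)
  ultimately show ?thesis by (simp add: r_def abs_mult p1_def)
qed

lemma rt_at_top: "filterlim rt at_top sequentially"
  unfolding rt_def by real_asymp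

lemma tendsto_divide_rt_power: "(\<lambda>n. c / rt n ^ Suc j) \<longlonglongrightarrow> 0"
  by (intro real_tendsto_divide_at_top[OF tendsto_const] filterlim_pow_at_top rt_at_top) auto

text \<open>
  In the exponent only \<open>(s^2/2 - s^6/30) / r^2\<close> survives multiplication by \<open>r^2 = sqrt n\<close>: the error of
  \<open>ln_rel_weight_bounds\<close> is \<open>O(r^(-4))\<close>, and passing from the lattice point \<open>s\<close> to \<open>t\<close> costs
  \<open>O(r^(-3))\<close>.
\<close>

lemma rel_weight_expansion:
  fixes t :: real and k :: "nat \<Rightarrow> nat"
  assumes k: "eventually (\<lambda>n. k n \<le> n \<and> \<bar>t - position n (k n)\<bar> \<le> 1 / rt n ^ 3) sequentially"
  shows "(\<lambda>n. (rt n)\<^sup>2 * (rel_weight n (k n) - p1 t)) \<longlonglongrightarrow> p2 t"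
proof -
  define s where "s = (\<lambda>n. position n (k n))"
  define \<psi> where "\<psi> = (\<lambda>n. ln (rel_weight n (k n)) + t^4 / 12)"
  define err where "err = (\<lambda>n. ln (rel_weight n (k n)) + s n ^ 4 / 12 - ((s n)\<^sup>2 / 2 - s n ^ 6 / 30) / (rt n)\<^sup>2)"
  have ev1: "eventually (\<lambda>n. 1 \<le> rt n) sequentially"
    using rt_at_top by (simp add: filterlim_at_top)
  have s: "s \<longlonglongrightarrow> t"
  proof -
    have "eventually (\<lambda>n. norm (s n - t) \<le> 1 / rt n ^ 3) sequentially"
      using k by eventually_elim (simp add: s_def abs_minus_commute)
    from Lim_null_comparison[OF this] have "(\<lambda>n. s n - t) \<longlonglongrightarrow> 0"
      using tendsto_divide_rt_power[of 1 2] by (simp add: numeral_3_eq_3)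
    then show ?thesis by (simp add: LIM_zero_iff)
  qed
  have "(\<lambda>n. (rt n)\<^sup>2 * err n) \<longlonglongrightarrow> 0"
  proof (rule Lim_null_comparison)
    have "eventually (\<lambda>n. \<bar>s n\<bar> < \<bar>t\<bar> + 1) sequentially"
      by (rule order_tendstoD(2)[OF tendsto_rabs[OF s]]) simp
    moreover have "eventually (\<lambda>n. 4/3 * (\<bar>t\<bar> + 1) \<le> rt n) sequentially"
      using rt_at_top unfolding filterlim_at_top by blast
    ultimately show "eventually (\<lambda>n. norm ((rt n)\<^sup>2 * err n) \<le> 4 * (1 + s n ^ 8) * (1 / rt n ^ Suc 1)) sequentially"
      using k ev1 eventually_ge_at_top[of 1]
    proof eventually_elim
      case (elim n)
      then have "\<bar>err n\<bar> \<le> 4 * (1 + s n ^ 8) / rt n ^ 4"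
        using ln_rel_weight_bounds(2)[of n "k n"] by (simp add: err_def s_def)
      then have "(rt n)\<^sup>2 * \<bar>err n\<bar> \<le> (rt n)\<^sup>2 * (4 * (1 + s n ^ 8) / rt n ^ 4)"
        by (intro mult_left_mono) auto
      also have "\<dots> = 4 * (1 + s n ^ 8) * (1 / rt n ^ Suc 1)"
        using elim by (simp add: field_simps numeral_eq_Suc)
      finally show ?case by (simp add: abs_mult)
    qed
    have "(\<lambda>n. 4 * (1 + s n ^ 8) * (1 / rt n ^ Suc 1)) \<longlonglongrightarrow> 4 * (1 + t^8) * 0"
      by (intro tendsto_intros s tendsto_divide_rt_power)
    then show "(\<lambda>n. 4 * (1 + s n ^ 8) * (1 / rt n ^ Suc 1)) \<longlonglongrightarrow> 0" by simp
  qed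
  moreover have "(\<lambda>n. (rt n)\<^sup>2 * (t^4 - s n ^ 4)) \<longlonglongrightarrow> 0"
  proof (rule Lim_null_comparison)
    show "eventually (\<lambda>n. norm ((rt n)\<^sup>2 * (t^4 - s n ^ 4)) \<le> \<bar>(t + s n) * (t\<^sup>2 + (s n)\<^sup>2)\<bar> * (1 / rt n ^ Suc 0)) sequentially"
      using k ev1
    proof eventually_elim
      case (elim n)
      have "(rt n)\<^sup>2 * (t^4 - s n ^ 4) = (rt n)\<^sup>2 * (t - s n) * ((t + s n) * (t\<^sup>2 + (s n)\<^sup>2))" by algebra
      then have "norm ((rt n)\<^sup>2 * (t^4 - s n ^ 4)) = \<bar>(rt n)\<^sup>2 * (t - s n) * ((t + s n) * (t\<^sup>2 + (s n)\<^sup>2))\<bar>"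
        by (simp only: real_norm_def)
      also have "\<dots> = (rt n)\<^sup>2 * \<bar>t - s n\<bar> * \<bar>(t + s n) * (t\<^sup>2 + (s n)\<^sup>2)\<bar>"
        by (simp add: abs_mult)
      also have "\<dots> \<le> (rt n)\<^sup>2 * (1 / rt n ^ 3) * \<bar>(t + s n) * (t\<^sup>2 + (s n)\<^sup>2)\<bar>"
        using elim by (intro mult_right_mono mult_left_mono) (auto simp: s_def)
      also have "(rt n)\<^sup>2 * (1 / rt n ^ 3) = 1 / rt n ^ Suc 0"
        using elim by (simp add: field_simps numeral_eq_Suc)
      finally show ?case by (simp add: mult.commute)
    qed
    have "(\<lambda>n. \<bar>(t + s n) * (t\<^sup>2 + (s n)\<^sup>2)\<bar> * (1 / rt n ^ Suc 0)) \<longlonglongrightarrow> \<bar>(t + t) * (t\<^sup>2 + t\<^sup>2)\<bar> * 0"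
      by (intro tendsto_intros s tendsto_divide_rt_power)
    then show "(\<lambda>n. \<bar>(t + s n) * (t\<^sup>2 + (s n)\<^sup>2)\<bar> * (1 / rt n ^ Suc 0)) \<longlonglongrightarrow> 0" by simp
  qed
  ultimately have "(\<lambda>n. ((s n)\<^sup>2 / 2 - s n ^ 6 / 30) + (rt n)\<^sup>2 * err n + (rt n)\<^sup>2 * (t^4 - s n ^ 4) / 12)
      \<longlonglongrightarrow> (t\<^sup>2 / 2 - t^6 / 30) + 0 + 0 / 12"
    by (intro tendsto_intros s) auto
  moreover have "eventually (\<lambda>n. ((s n)\<^sup>2 / 2 - s n ^ 6 / 30) + (rt n)\<^sup>2 * err n + (rt n)\<^sup>2 * (t^4 - s n ^ 4) / 12
      = (rt n)\<^sup>2 * \<psi> n) sequentially"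
    using ev1 by eventually_elim (simp add: err_def \<psi>_def field_simps)
  ultimately have \<psi>: "(\<lambda>n. (rt n)\<^sup>2 * \<psi> n) \<longlonglongrightarrow> t\<^sup>2 / 2 - t^6 / 30"
    by (simp add: filterlim_cong)
  have "\<psi> \<longlonglongrightarrow> 0"
  proof -
    have "(\<lambda>n. ((rt n)\<^sup>2 * \<psi> n) * (1 / rt n ^ Suc 1)) \<longlonglongrightarrow> (t\<^sup>2 / 2 - t^6 / 30) * 0"
      by (intro tendsto_intros \<psi> tendsto_divide_rt_power)
    moreover have "eventually (\<lambda>n. ((rt n)\<^sup>2 * \<psi> n) * (1 / rt n ^ Suc 1) = \<psi> n) sequentially"
      using ev1 by eventually_elim (simp add: field_simps numeral_eq_Suc)
    ultimately show ?thesis by (simp add: filterlim_cong)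
  qed
  have "(\<lambda>n. (rt n)\<^sup>2 * (exp (\<psi> n) - 1)) \<longlonglongrightarrow> t\<^sup>2 / 2 - t^6 / 30"
  proof -
    \<comment> \<open>The difference quotient of \<open>exp\<close> at \<open>0\<close>, completed continuously to cover zeros of \<open>\<psi>\<close>.\<close>
    define q where "q = (\<lambda>x::real. if x = 0 then 1 else (exp x - 1) / x)"
    have "((\<lambda>x::real. (exp x - 1) / x) \<longlongrightarrow> 1) (at 0)"
      using DERIV_exp[of 0] by (simp add: has_field_derivative_iff)
    then have "(q \<longlongrightarrow> 1) (at 0)"
      by (rule Lim_transform_eventually) (auto simp: q_def eventually_at_filter)
    then have "isCont q 0" by (simp add: isCont_def q_def)
    then have "(\<lambda>n. q (\<psi> n)) \<longlonglongrightarrow> q 0"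
      using \<open>\<psi> \<longlonglongrightarrow> 0\<close> isCont_tendsto_compose by blast
    from tendsto_mult[OF \<psi> this] have "(\<lambda>n. (rt n)\<^sup>2 * \<psi> n * q (\<psi> n)) \<longlonglongrightarrow> t\<^sup>2 / 2 - t^6 / 30"
      by (simp add: q_def)
    moreover have "(rt n)\<^sup>2 * \<psi> n * q (\<psi> n) = (rt n)\<^sup>2 * (exp (\<psi> n) - 1)" for n
      by (simp add: q_def)
    ultimately show ?thesis by simp
  qed
  from tendsto_mult_right[OF this, of "p1 t"]
  have "(\<lambda>n. (rt n)\<^sup>2 * (exp (\<psi> n) - 1) * p1 t) \<longlonglongrightarrow> p2 t"
    by (simp add: p1_def p2_def)
  moreover have "eventually (\<lambda>n. (rt n)\<^sup>2 * (exp (\<psi> n) - 1) * p1 t = (rt n)\<^sup>2 * (rel_weight n (k n) - p1 t)) sequentially"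
    using k
  proof eventually_elim
    case (elim n)
    then have "rel_weight n (k n) = exp (\<psi> n) * p1 t"
      using rel_weight_pos[of "k n" n] by (simp add: \<psi>_def p1_def exp_add exp_minus)
    then show ?case by (simp add: algebra_simps)
  qed
  ultimately show ?thesis by (rule Lim_transform_eventually)
qed

section \<open>The law of the magnetization\<close>

lemma sum_pairs_eq:
  fixes \<sigma> :: "nat \<Rightarrow> real"
  shows "2 * (\<Sum>(i, j) \<in> {(i, j). 1 \<le> i \<and> i < j \<and> j \<le> n}. \<sigma> i * \<sigma> j)
    = (\<Sum>i = 1..n. \<sigma> i)\<^sup>2 - (\<Sum>i = 1..n. (\<sigma> i)\<^sup>2)"
proof (induction n)
  case 0
  have "{(i, j). 1 \<le> i \<and> i < j \<and> j \<le> (0::nat)} = {}" by auto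
  then show ?case by (simp only: sum.empty) simp
next
  case (Suc n)
  let ?A = "{(i, j). 1 \<le> i \<and> i < j \<and> j \<le> n}" and ?B = "{1..n} \<times> {Suc n}"
  have "{(i, j). 1 \<le> i \<and> i < j \<and> j \<le> Suc n} = ?A \<union> ?B" by auto
  moreover have "finite ?A" by (rule finite_subset[of _ "{..n} \<times> {..n}"]) auto
  ultimately have "(\<Sum>(i, j) \<in> {(i, j). 1 \<le> i \<and> i < j \<and> j \<le> Suc n}. \<sigma> i * \<sigma> j)
    = (\<Sum>(i, j) \<in> ?A. \<sigma> i * \<sigma> j) + (\<Sum>(i, j) \<in> ?B. \<sigma> i * \<sigma> j)"
    by (simp add: sum.union_disjoint disjoint_iff)
  also have "(\<Sum>(i, j) \<in> ?B. \<sigma> i * \<sigma> j) = (\<Sum>i = 1..n. \<sigma> i) * \<sigma> (Suc n)"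
    by (simp add: sum.cartesian_product[symmetric] sum_distrib_right)
  finally show ?case using Suc.IH by (simp add: power2_sum algebra_simps)
qed

lemma cw_weight_critical:
  assumes "1 \<le> n" "\<sigma> \<in> configs n"
  shows "cw_weight 1 0 n \<sigma> = exp (- 1/2) * exp ((magnetization n \<sigma>)\<^sup>2 / (2 * real n))"
proof -
  have "(\<Sum>i = 1..n. (\<sigma> i)\<^sup>2) = (\<Sum>i = 1..n. 1)"
    using assms by (intro sum.cong) (auto simp: configs_def PiE_iff power2_eq_1_iff)
  then have "(\<Sum>(i, j) \<in> {(i, j). 1 \<le> i \<and> i < j \<and> j \<le> n}. \<sigma> i * \<sigma> j) = ((magnetization n \<sigma>)\<^sup>2 - real n) / 2"
    using sum_pairs_eq[of \<sigma> n] by (simp add: magnetization_def)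
  then show ?thesis
    using assms(1) by (simp add: cw_weight_def diff_divide_distrib flip: exp_add)
qed

text \<open>
  Configurations correspond to their sets of plus spins, which are then counted by cardinality.
\<close>

lemma sum_configs:
  fixes f :: "real \<Rightarrow> real"
  shows "(\<Sum>\<sigma> \<in> configs n. f (magnetization n \<sigma>)) = (\<Sum>k\<le>n. real (n choose k) * f (2 * real k - real n))"
proof -
  let ?up = "\<lambda>\<sigma>. {i \<in> {1..n}. \<sigma> i = (1::real)}"
  let ?spin = "\<lambda>A. \<lambda>i\<in>{1..n}. if i \<in> A then 1 else (- 1 :: real)"
  have "(\<Sum>\<sigma> \<in> configs n. f (magnetization n \<sigma>)) = (\<Sum>A \<in> Pow {1..n}. f (2 * real (card A) - real n))"
  proof (rule sum.reindex_bij_witness[of _ ?spin ?up])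
    fix \<sigma> assume \<sigma>: "\<sigma> \<in> configs n"
    then have v: "\<sigma> i = 1 \<or> \<sigma> i = - 1" if "i \<in> {1..n}" for i
      using that by (auto simp: configs_def PiE_iff)
    show "?spin (?up \<sigma>) = \<sigma>"
    proof
      fix i show "?spin (?up \<sigma>) i = \<sigma> i"
        using \<sigma> v[of i] by (cases "i \<in> {1..n}") (auto simp: configs_def PiE_def extensional_def)
    qed
    have "magnetization n \<sigma> = (\<Sum>i\<in>{1..n}. 2 * (if \<sigma> i = 1 then 1 else 0) - 1)"
      unfolding magnetization_def by (intro sum.cong refl) (use v in fastforce)
    also have "\<dots> = 2 * (\<Sum>i\<in>{1..n}. if \<sigma> i = 1 then 1 else 0) - real n"
      by (simp add: sum_subtractf sum_distrib_left)
    also have "(\<Sum>i\<in>{1..n}. if \<sigma> i = 1 then 1 else 0) = real (card (?up \<sigma>))"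
      by (simp add: sum.If_cases Int_def)
    finally show "f (2 * real (card (?up \<sigma>)) - real n) = f (magnetization n \<sigma>)" by simp
  qed (auto simp: configs_def)
  also have "\<dots> = (\<Sum>k\<le>n. \<Sum>A\<in>{A \<in> Pow {1..n}. card A = k}. f (2 * real (card A) - real n))"
    by (rule sum.group[symmetric]) (auto dest: card_mono[rotated])
  also have "\<dots> = (\<Sum>k\<le>n. \<Sum>A\<in>{A. A \<subseteq> {1..n} \<and> card A = k}. f (2 * real k - real n))"
    by (intro sum.cong) auto
  also have "\<dots> = (\<Sum>k\<le>n. real (n choose k) * f (2 * real k - real n))"
    by (simp add: n_subsets)
  finally show ?thesis .
qed

lemma prob_scaled_magnetization:
  assumes n: "1 \<le> n"
  shows "\<P>(\<sigma> in critical_curie_weiss n. Q (scaled_magnetization n \<sigma>))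
    = (\<Sum>k | k \<le> n \<and> Q (position n k). level_weight n k) / (\<Sum>k\<le>n. level_weight n k)"
proof -
  let ?g = "\<lambda>m. exp (m\<^sup>2 / (2 * real n))"
  let ?Q = "\<lambda>m. if Q (m / rt n ^ 3) then 1 else (0::real)"
  let ?Z = "cw_partition 1 0 n"
  have Z: "?Z = exp (- 1/2) * (\<Sum>k\<le>n. level_weight n k)"
  proof -
    have "?Z = (\<Sum>\<sigma> \<in> configs n. exp (- 1/2) * ?g (magnetization n \<sigma>))"
      unfolding cw_partition_def by (intro sum.cong refl cw_weight_critical[OF n])
    also have "\<dots> = (\<Sum>k\<le>n. real (n choose k) * (exp (- 1/2) * ?g (2 * real k - real n)))"
      by (rule sum_configs[of "\<lambda>m. exp (- 1/2) * ?g m"])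
    finally show ?thesis by (simp add: level_weight_def sum_distrib_left algebra_simps)
  qed
  have sp: "space (critical_curie_weiss n) = configs n"
    by (simp add: curie_weiss_def space_point_measure)
  have nn: "0 \<le> cw_weight 1 0 n \<sigma> / ?Z" for \<sigma>
    using cw_partition_pos[of 1 0 n] by (simp add: cw_weight_def)
  have scaled: "scaled_magnetization n \<sigma> = magnetization n \<sigma> / rt n ^ 3" for \<sigma>
    unfolding scaled_magnetization_def rt_powers(4)[OF n] ..
  have "emeasure (critical_curie_weiss n) {\<sigma> \<in> configs n. Q (scaled_magnetization n \<sigma>)}
     = (\<Sum>\<sigma> | \<sigma> \<in> configs n \<and> Q (scaled_magnetization n \<sigma>). ennreal (cw_weight 1 0 n \<sigma> / ?Z))"
    unfolding curie_weiss_def by (rule emeasure_point_measure_finite[OF finite_configs]) auto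
  also have "\<dots> = ennreal (\<Sum>\<sigma> | \<sigma> \<in> configs n \<and> Q (scaled_magnetization n \<sigma>). cw_weight 1 0 n \<sigma> / ?Z)"
    using nn by (intro sum_ennreal) auto
  finally have "\<P>(\<sigma> in critical_curie_weiss n. Q (scaled_magnetization n \<sigma>))
     = (\<Sum>\<sigma> | \<sigma> \<in> configs n \<and> Q (scaled_magnetization n \<sigma>). cw_weight 1 0 n \<sigma> / ?Z)"
    unfolding measure_def sp using nn by (simp add: sum_nonneg)
  also have "\<dots> = (\<Sum>\<sigma> \<in> configs n. ?Q (magnetization n \<sigma>) * (exp (- 1/2) * ?g (magnetization n \<sigma>) / ?Z))"
    unfolding sum.inter_filter[OF finite_configs]
    by (intro sum.cong refl) (simp add: cw_weight_critical[OF n] scaled)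
  also have "\<dots> = (\<Sum>k\<le>n. real (n choose k) * (?Q (2 * real k - real n) * (exp (- 1/2) * ?g (2 * real k - real n) / ?Z)))"
    by (rule sum_configs[of "\<lambda>m. ?Q m * (exp (- 1/2) * ?g m / ?Z)"])
  also have "\<dots> = (\<Sum>k\<in>{..n}. if Q (position n k) then level_weight n k / (\<Sum>k\<le>n. level_weight n k) else 0)"
    by (intro sum.cong refl) (simp add: position_def Z level_weight_def)
  also have "\<dots> = (\<Sum>k | k \<in> {..n} \<and> Q (position n k). level_weight n k / (\<Sum>k\<le>n. level_weight n k))"
    by (subst sum.inter_filter) simp_all
  finally show ?thesis by (simp add: sum_divide_distrib)
qed

section \<open>Sums of weights as integrals of a step function\<close>

text \<open>
  The points \<open>position n k\<close> have spacing \<open>2 / n^(3/4)\<close>, so these half-open cells around them are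
  disjoint and tile an interval. All of them having the same length, sums of \<open>rel_weight n\<close> over sets
  of \<open>k\<close> are proportional to integrals of the step function \<open>profile n\<close> defined below.
\<close>

definition cell :: "nat \<Rightarrow> nat \<Rightarrow> real set" where
  "cell n k = {(2 * real k - real n - 1) / rt n ^ 3 ..< (2 * real k - real n + 1) / rt n ^ 3}"

definition profile :: "nat \<Rightarrow> real \<Rightarrow> real" where
  "profile n t = (\<Sum>k\<le>n. rel_weight n k * indicator (cell n k) t)"

lemma mem_cell_iff:
  assumes "1 \<le> n"
  shows "t \<in> cell n k \<longleftrightarrow> 2 * real k - real n - 1 \<le> t * rt n ^ 3 \<and> t * rt n ^ 3 < 2 * real k - real n + 1"
  using rt_powers(1)[OF assms] by (simp add: cell_def pos_divide_le_eq pos_less_divide_eq)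

lemma cell_near_position:
  assumes "t \<in> cell n k" shows "\<bar>t - position n k\<bar> \<le> 1 / rt n ^ 3"
proof -
  have "cell n k = {position n k - 1 / rt n ^ 3 ..< position n k + 1 / rt n ^ 3}"
    unfolding cell_def position_def diff_divide_distrib add_divide_distrib ..
  then show ?thesis using assms by (simp add: abs_le_iff)
qed

lemma profile_on_cell:
  assumes n: "1 \<le> n" and k: "k \<le> n" "t \<in> cell n k"
  shows "profile n t = rel_weight n k"
proof -
  have iff: "t \<in> cell n l \<longleftrightarrow> l = k" for l
  proof
    assume l: "t \<in> cell n l"
    have "2 * real l - real n - 1 \<le> t * rt n ^ 3" "t * rt n ^ 3 < 2 * real l - real n + 1"
      "2 * real k - real n - 1 \<le> t * rt n ^ 3" "t * rt n ^ 3 < 2 * real k - real n + 1"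
      using l k(2) unfolding mem_cell_iff[OF n] by blast+
    then have "real l < real k + 1" "real k < real l + 1" by linarith+
    then show "l = k" by linarith
  qed (use k in simp)
  have "profile n t = (\<Sum>l\<le>n. if k = l then rel_weight n l else 0)"
    unfolding profile_def indicator_def by (intro sum.cong refl) (simp add: iff)
  then show ?thesis using k by (simp only: sum.delta' finite_atMost atMost_iff if_True)
qed

text \<open>
  The cells cover \<open>[- (n + 1) / n^(3/4), (n + 1) / n^(3/4))\<close>, which contains \<open>(- n^(1/4), n^(1/4))\<close>.
\<close>

lemma ex_cell:
  assumes n: "1 \<le> n" and t: "\<bar>t\<bar> < rt n"
  shows "\<exists>k\<le>n. t \<in> cell n k"
proof -
  define u where "u = (t * rt n ^ 3 + real n + 1) / 2"
  have "\<bar>t\<bar> * rt n ^ 3 < rt n * rt n ^ 3"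
    using t rt_powers(1)[OF n] by (intro mult_strict_right_mono) auto
  then have "\<bar>t * rt n ^ 3\<bar> < real n"
    using rt_powers(1,2)[OF n] by (simp add: abs_mult numeral_eq_Suc)
  then have u: "1/2 < u" "u < real n + 1/2" by (auto simp: u_def)
  define k where "k = nat \<lfloor>u\<rfloor>"
  have k: "real k \<le> u" "u < real k + 1" using u unfolding k_def by linarith+
  then have "real k < real n + 1" using u by linarith
  then have "k \<le> n" by linarith
  moreover have "t \<in> cell n k" using k by (auto simp: mem_cell_iff[OF n] u_def)
  ultimately show ?thesis by blast
qed

lemma profile_eq_0:
  assumes "\<And>k. k \<le> n \<Longrightarrow> t \<notin> cell n k" shows "profile n t = 0"
  unfolding profile_def using assms by (intro sum.neutral) auto

text \<open>
  On the cells this is \<open>rel_weight_close_p1\<close>. Off the cells the step function vanishes, but then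
  \<open>\<bar>t\<bar> \<ge> n^(1/4)\<close>, hence \<open>1 + t^6 \<ge> sqrt n\<close>, and the right-hand side exceeds \<open>p1 t\<close>.
\<close>

lemma profile_close_p1:
  assumes n: "1 \<le> n"
  shows "\<bar>profile n t - p1 t\<bar> \<le> 10 * exp 25 * (1 + t^6) / (rt n)\<^sup>2 * p1 t"
proof (cases "\<exists>k\<le>n. t \<in> cell n k")
  case True
  then obtain k where k: "k \<le> n" "t \<in> cell n k" by blast
  then show ?thesis
    using rel_weight_close_p1[OF n k(1) cell_near_position[OF k(2)]] profile_on_cell[OF n k] by simp
next
  case False
  then have "rt n \<le> \<bar>t\<bar>" using ex_cell[OF n, of t] by force
  then have "(rt n)\<^sup>2 \<le> t\<^sup>2" using rt_powers(1)[OF n] by (subst abs_le_square_iff[symmetric]) auto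
  also have "\<dots> \<le> 1 + t^6" by (rule power2_le_power6)
  also have "\<dots> \<le> 10 * exp 25 * (1 + t^6)"
  proof -
    have "1 \<le> exp (25::real)" by simp
    then have "1 * (1 + t^6) \<le> 10 * exp 25 * (1 + t^6)" by (intro mult_right_mono) (linarith | simp)+
    then show ?thesis by simp
  qed
  finally have "1 \<le> 10 * exp 25 * (1 + t^6) / (rt n)\<^sup>2"
    using rt_powers(1)[OF n] by (simp add: pos_le_divide_eq)
  then have "1 * p1 t \<le> 10 * exp 25 * (1 + t^6) / (rt n)\<^sup>2 * p1 t"
    by (intro mult_right_mono) (auto simp: p1_def)
  moreover have "profile n t = 0" using False by (intro profile_eq_0) auto
  ultimately show ?thesis by (simp add: p1_def)
qed

lemma profile_expansion: "(\<lambda>n. (rt n)\<^sup>2 * (profile n t - p1 t)) \<longlonglongrightarrow> p2 t"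
proof -
  define k where "k = (\<lambda>n. SOME k. k \<le> n \<and> t \<in> cell n k)"
  have "eventually (\<lambda>n. \<bar>t\<bar> + 1 \<le> rt n) sequentially"
    using rt_at_top unfolding filterlim_at_top by blast
  then have k: "eventually (\<lambda>n. 1 \<le> n \<and> k n \<le> n \<and> t \<in> cell n (k n)) sequentially"
    using eventually_ge_at_top[of 1]
  proof eventually_elim
    case (elim n)
    then have "\<exists>k. k \<le> n \<and> t \<in> cell n k" using ex_cell[of n t] by auto
    from someI_ex[OF this] show ?case using elim by (simp add: k_def)
  qed
  have "(\<lambda>n. (rt n)\<^sup>2 * (rel_weight n (k n) - p1 t)) \<longlonglongrightarrow> p2 t"
    by (rule rel_weight_expansion) (use k in eventually_elim, auto intro: cell_near_position)
  moreover have "eventually (\<lambda>n. (rt n)\<^sup>2 * (rel_weight n (k n) - p1 t) = (rt n)\<^sup>2 * (profile n t - p1 t)) sequentially"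
    using k
  proof eventually_elim
    case (elim n)
    then have "profile n t = rel_weight n (k n)" using profile_on_cell[of n "k n" t] by blast
    then show ?case by simp
  qed
  ultimately show ?thesis by (rule Lim_transform_eventually)
qed

text \<open>
  The left end of the first cell whose centre lies strictly to the right of \<open>x\<close>, in the lattice
  continued beyond \<open>k \<le> n\<close>.
\<close>

definition lattice_edge :: "nat \<Rightarrow> real \<Rightarrow> real" where
  "lattice_edge n x = (2 * real_of_int (\<lfloor>(x * rt n ^ 3 + real n) / 2\<rfloor> + 1) - real n - 1) / rt n ^ 3"

lemma lattice_edge_near:
  assumes n: "1 \<le> n" shows "\<bar>lattice_edge n x - x\<bar> \<le> 1 / rt n ^ 3"
proof -
  have r: "0 < rt n ^ 3" using rt_powers(1)[OF n] by simp
  define u where "u = (x * rt n ^ 3 + real n) / 2"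
  have xu: "x * rt n ^ 3 = 2 * u - real n" by (simp add: u_def field_simps)
  define m where "m = real_of_int \<lfloor>u\<rfloor>"
  have "m \<le> u" "u < m + 1" unfolding m_def by linarith+
  then have "\<bar>2 * (m + 1) - real n - 1 - x * rt n ^ 3\<bar> \<le> 1"
    unfolding xu abs_le_iff by simp
  moreover have "lattice_edge n x - x
      = (2 * (m + 1) - real n - 1 - x * rt n ^ 3) / rt n ^ 3"
    using r unfolding lattice_edge_def u_def[symmetric] of_int_add m_def[symmetric] by (simp add: diff_divide_distrib)
  ultimately show ?thesis using r by (simp only: abs_divide abs_of_pos divide_right_mono less_imp_le)
qed

lemma cell_Int_lattice_edge:
  assumes n: "1 \<le> n"
  shows "cell n k \<inter> {lattice_edge n x..} = (if x < position n k then cell n k else {})"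
proof -
  \<comment> \<open>The first index \<open>k\<close>, possibly negative or beyond \<open>n\<close>, whose position exceeds \<open>x\<close>.\<close>
  define \<kappa> where "\<kappa> = \<lfloor>(x * rt n ^ 3 + real n) / 2\<rfloor> + 1"
  have r: "0 < rt n ^ 3" using rt_powers(1)[OF n] by simp
  have "x < position n k \<longleftrightarrow> (x * rt n ^ 3 + real n) / 2 < real k"
    using r by (auto simp: position_def field_simps)
  also have "\<dots> \<longleftrightarrow> \<kappa> \<le> int k" unfolding \<kappa>_def by linarith
  finally have iff: "x < position n k \<longleftrightarrow> \<kappa> \<le> int k" .
  have edge: "lattice_edge n x \<le> t \<longleftrightarrow> 2 * real_of_int \<kappa> - real n - 1 \<le> t * rt n ^ 3" for t
    using r by (simp add: lattice_edge_def \<kappa>_def pos_divide_le_eq)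
  show ?thesis
  proof (cases "\<kappa> \<le> int k")
    case True
    then have "real_of_int \<kappa> \<le> real k" by linarith
    then have "cell n k \<subseteq> {lattice_edge n x..}" by (auto simp: edge mem_cell_iff[OF n])
    then show ?thesis using True iff by auto
  next
    case False
    then have "real k + 1 \<le> real_of_int \<kappa>" by linarith
    then have "cell n k \<inter> {lattice_edge n x..} = {}" by (auto simp: edge mem_cell_iff[OF n])
    then show ?thesis using False iff by auto
  qed
qed

lemma cell_measure:
  assumes n: "1 \<le> n"
  shows "cell n k \<in> sets lborel" "emeasure lborel (cell n k) < \<infinity>" "measure lborel (cell n k) = 2 / rt n ^ 3"
  using rt_powers(1)[OF n] by (auto simp: cell_def divide_right_mono diff_divide_distrib add_divide_distrib)

lemma integrable_profile: "1 \<le> n \<Longrightarrow> integrable lborel (profile n)"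
  unfolding profile_def by (intro Bochner_Integration.integrable_sum integrable_mult_right integrable_real_indicator cell_measure)

lemma profile_integral:
  assumes n: "1 \<le> n"
  shows "(LBINT t. profile n t) = 2 / rt n ^ 3 * (\<Sum>k\<le>n. rel_weight n k)"
proof -
  have "(LBINT t. profile n t) = (\<Sum>k\<le>n. LBINT t. rel_weight n k * indicator (cell n k) t)"
    unfolding profile_def by (intro Bochner_Integration.integral_sum integrable_mult_right integrable_real_indicator cell_measure n)
  also have "\<dots> = (\<Sum>k\<le>n. rel_weight n k * (2 / rt n ^ 3))"
    using cell_measure[OF n] by simp
  finally show ?thesis by (simp only: sum_distrib_right[symmetric] mult.commute atMost_iff)
qed

lemma profile_tail_integral:
  assumes n: "1 \<le> n"
  shows "(LBINT t:{lattice_edge n x..}. profile n t) = 2 / rt n ^ 3 * (\<Sum>k | k \<le> n \<and> x < position n k. rel_weight n k)"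
proof -
  have "indicator {lattice_edge n x..} t * profile n t
      = (\<Sum>k\<le>n. (if x < position n k then rel_weight n k else 0) * indicator (cell n k) t)" for t
  proof -
    have summand: "indicator {lattice_edge n x..} t * (rel_weight n k * indicator (cell n k) t)
        = (if x < position n k then rel_weight n k else 0) * indicator (cell n k) t" for k
    proof -
      have "indicator {lattice_edge n x..} t * indicator (cell n k) t
          = (indicator (cell n k \<inter> {lattice_edge n x..}) t :: real)"
        by (simp add: indicator_inter_arith)
      also have "\<dots> = (if x < position n k then 1 else 0) * indicator (cell n k) t"
        unfolding cell_Int_lattice_edge[OF n] by simp
      finally have *: "indicator {lattice_edge n x..} t * indicator (cell n k) t
          = ((if x < position n k then 1 else 0) * indicator (cell n k) t :: real)" .
      have "indicator {lattice_edge n x..} t * (rel_weight n k * indicator (cell n k) t)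
          = rel_weight n k * (indicator {lattice_edge n x..} t * indicator (cell n k) t)" by simp
      also have "\<dots> = rel_weight n k * ((if x < position n k then 1 else 0) * indicator (cell n k) t)"
        by (simp only: *)
      also have "\<dots> = (if x < position n k then rel_weight n k else 0) * indicator (cell n k) t" by simp
      finally show ?thesis .
    qed
    show ?thesis unfolding profile_def sum_distrib_left by (intro sum.cong refl summand)
  qed
  then have "(LBINT t:{lattice_edge n x..}. profile n t)
      = (LBINT t. (\<Sum>k\<le>n. (if x < position n k then rel_weight n k else 0) * indicator (cell n k) t))"
    unfolding set_lebesgue_integral_def by simp
  also have "\<dots> = (\<Sum>k\<le>n. LBINT t. (if x < position n k then rel_weight n k else 0) * indicator (cell n k) t)"
    by (intro Bochner_Integration.integral_sum integrable_mult_right integrable_real_indicator cell_measure n)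
  also have "\<dots> = (\<Sum>k\<in>{..n}. if x < position n k then rel_weight n k * (2 / rt n ^ 3) else 0)"
    using cell_measure[OF n] by (intro sum.cong) auto
  also have "\<dots> = (\<Sum>k | k \<in> {..n} \<and> x < position n k. rel_weight n k * (2 / rt n ^ 3))"
    by (subst sum.inter_filter) simp_all
  finally show ?thesis by (simp only: sum_distrib_right[symmetric] mult.commute atMost_iff)
qed

lemma central_level_weight_nz: "1 \<le> n \<Longrightarrow> level_weight n ((n + 1) div 2) \<noteq> 0"
  using level_weight_pos[of "(n + 1) div 2" n] by fastforce

lemma profile_integral_pos:
  assumes n: "1 \<le> n" shows "2 / rt n ^ 3 \<le> (LBINT t. profile n t)"
proof -
  have "rel_weight n ((n + 1) div 2) \<le> (\<Sum>k\<le>n. rel_weight n k)"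
    using rel_weight_pos[of _ n] n by (intro member_le_sum) (auto intro: less_imp_le)
  moreover have "rel_weight n ((n + 1) div 2) = 1"
    using central_level_weight_nz[OF n] by (simp add: rel_weight_def)
  ultimately have "2 / rt n ^ 3 * 1 \<le> 2 / rt n ^ 3 * (\<Sum>k\<le>n. rel_weight n k)"
    using rt_powers(1)[OF n] by (intro mult_left_mono) auto
  then show ?thesis by (simp add: profile_integral[OF n])
qed

text \<open>
  This is where the cut at the end of a cell pays off: the tail probability is an exact quotient of
  integrals, without boundary terms.
\<close>

lemma prob_tail_eq_profile_ratio:
  assumes n: "1 \<le> n"
  shows "\<P>(\<sigma> in critical_curie_weiss n. scaled_magnetization n \<sigma> > x)
    = (LBINT t:{lattice_edge n x..}. profile n t) / (LBINT t. profile n t)"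
proof -
  show ?thesis
    using central_level_weight_nz[OF n] rt_powers(1)[OF n]
    unfolding prob_scaled_magnetization[OF n] profile_integral[OF n] profile_tail_integral[OF n]
    by (simp add: rel_weight_def flip: sum_divide_distrib)
qed

section \<open>Tails of the quartic density\<close>

lemma p1_pos: "0 < p1 t" by (simp add: p1_def)

lemma p1_le_1: "p1 t \<le> 1" by (simp add: p1_def)

lemma p1_measurable [measurable]: "p1 \<in> borel_measurable borel"
  unfolding p1_def by measurable

lemma p2_measurable [measurable]: "p2 \<in> borel_measurable borel"
  unfolding p2_def by measurable

lemma integrable_p1_moment: "integrable lborel (\<lambda>t. t ^ k * p1 t)"
proof (rule Bochner_Integration.integrable_bound)
  show "integrable lborel (\<lambda>t. sqrt (2 * pi) * exp (3/4) * (std_normal_density t * t ^ k))"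
    using integrable_std_normal_moment by (intro integrable_mult_right) auto
  show "AE t in lborel. norm (t ^ k * p1 t) \<le> norm (sqrt (2 * pi) * exp (3/4) * (std_normal_density t * t ^ k))"
  proof (intro AE_I2)
    fix t :: real
    \<comment> \<open>Completing the square shows that \<open>p1\<close> lies below a multiple of the Gaussian density.\<close>
    have "0 \<le> (t\<^sup>2 - 3)\<^sup>2 / 12" by simp
    also have "(t\<^sup>2 - 3)\<^sup>2 / 12 = t^4 / 12 - t\<^sup>2 / 2 + 3/4"
      by (simp add: power2_diff diff_divide_distrib add_divide_distrib flip: power_mult)
    finally have "p1 t \<le> exp (3/4) * exp (- t\<^sup>2 / 2)"
      by (simp add: p1_def flip: exp_add)
    then have "\<bar>t ^ k\<bar> * p1 t \<le> \<bar>t ^ k\<bar> * (exp (3/4) * exp (- t\<^sup>2 / 2))" by (intro mult_left_mono) auto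
    also have "\<dots> = norm (sqrt (2 * pi) * exp (3/4) * (std_normal_density t * t ^ k))"
      by (simp add: std_normal_density_def abs_mult)
    finally show "norm (t ^ k * p1 t) \<le> norm (sqrt (2 * pi) * exp (3/4) * (std_normal_density t * t ^ k))"
      using p1_pos[of t] by (simp add: abs_mult)
  qed
qed measurable

lemma integrable_p1: "integrable lborel p1"
  using integrable_p1_moment[of 0] by simp

lemma integrable_weighted_p1: "integrable lborel (\<lambda>t. (1 + t^6) * p1 t)"
  using Bochner_Integration.integrable_add[OF integrable_p1 integrable_p1_moment[of 6]]
  by (simp add: distrib_right)

definition p1_tail :: "real \<Rightarrow> real" where "p1_tail x = (LBINT t:{x..}. p1 t)"

lemma integrable_tail:
  fixes f :: "real \<Rightarrow> real"
  assumes "integrable lborel f" shows "integrable lborel (\<lambda>t. indicator {x..} t * f t)"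
  using integrable_mult_indicator[OF _ assms, of "{x..}"] by simp

text \<open>
  The exponent \<open>t^4 / 12\<close> has slope \<open>x^3 / 3\<close> at \<open>x\<close>, so \<open>p1\<close> stays comparable to \<open>p1 x\<close> on an interval
  of length \<open>1 / (1 + x^3)\<close> to the right of \<open>x\<close>.
\<close>

lemma p1_le_p1_tail:
  assumes x: "0 \<le> x" shows "p1 x \<le> exp (5/4) * (1 + x^3) * p1_tail x"
proof -
  define s where "s = 1 / (1 + x^3)"
  have x3: "0 \<le> x^3" using x by simp
  have s: "0 < s" "s \<le> 1" "x^3 * s \<le> 1" using x3 unfolding s_def by (simp_all add: add_pos_nonneg pos_divide_le_eq)
  have xs: "0 \<le> x * s" "x * s \<le> 1"
  proof -
    have "x \<le> 1 + x^3"
    proof (cases "x \<le> 1")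
      case False
      then have "x^1 \<le> x^3" by (intro power_increasing) auto
      then show ?thesis by simp
    qed (use x3 in linarith)
    then show "x * s \<le> 1" using x3 by (simp add: s_def pos_divide_le_eq add_pos_nonneg)
    show "0 \<le> x * s" using x s by simp
  qed
  have *: "exp (- 5/4) * p1 x \<le> p1 t" if t: "x \<le> t" "t \<le> x + s" for t
  proof -
    have "t^4 \<le> (x + s)^4" using t x by (intro power_mono) auto
    also have "\<dots> = x^4 + 4 * (x^3 * s) + 6 * (x * s)^2 + 4 * ((x * s) * s^2) + s^4" by algebra
    also have "\<dots> \<le> x^4 + 4 * 1 + 6 * 1 + 4 * (1 * 1) + 1"
      using s xs by (intro add_mono mult_left_mono mult_mono power_le_one) auto
    finally have "- 5/4 + - (x^4) / 12 \<le> - (t^4) / 12" by simp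
    then show ?thesis unfolding p1_def exp_add[symmetric] by simp
  qed
  have "(LBINT t. indicator {x..x + s} t * (exp (- 5/4) * p1 x)) \<le> (LBINT t. indicator {x..} t * p1 t)"
  proof (rule integral_mono)
    show "indicator {x..x + s} t * (exp (- 5/4) * p1 x) \<le> indicator {x..} t * p1 t" for t
      using * p1_pos[of t] by (auto simp: indicator_def less_imp_le)
  qed (use s in \<open>auto intro!: integrable_tail integrable_p1 integrable_mult_left integrable_real_indicator\<close>)
  then have "s * (exp (- 5/4) * p1 x) \<le> p1_tail x"
    using s by (simp add: p1_tail_def set_lebesgue_integral_def)
  then have "exp (5/4) * (1 + x^3) * (s * (exp (- 5/4) * p1 x)) \<le> exp (5/4) * (1 + x^3) * p1_tail x"
    using x3 by (intro mult_left_mono) auto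
  also have "exp (5/4) * (1 + x^3) * (s * (exp (- 5/4) * p1 x)) = p1 x"
  proof -
    have "1 + x^3 \<noteq> 0" using x3 by linarith
    then have "(1 + x^3) * s = 1" by (simp add: s_def)
    moreover have "exp (5/4) * exp (- 5/4) = (1::real)" by (simp flip: exp_add)
    ultimately have "((1 + x^3) * s) * (exp (5/4) * exp (- 5/4)) * p1 x = p1 x" by simp
    then show ?thesis by (simp only: mult_ac)
  qed
  finally show ?thesis .
qed

lemma p1_tail_antimono: "x \<le> y \<Longrightarrow> p1_tail y \<le> p1_tail x"
  unfolding p1_tail_def set_lebesgue_integral_def
  by (rule integral_mono; (intro integrable_tail[OF integrable_p1, folded real_scaleR_def])?)
     (use p1_pos in \<open>auto simp: indicator_def less_imp_le\<close>)

lemma p1_tail_pos: "0 < p1_tail x"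
proof -
  have "0 < exp (5/4) * (1 + \<bar>x\<bar>^3) * p1_tail \<bar>x\<bar>"
    using p1_pos[of "\<bar>x\<bar>"] p1_le_p1_tail[of "\<bar>x\<bar>"] by linarith
  moreover have "0 < exp (5/4) * (1 + \<bar>x\<bar>^3)" by (simp add: add_pos_nonneg)
  ultimately have "0 < p1_tail \<bar>x\<bar>" by (simp only: zero_less_mult_pos)
  then show ?thesis using p1_tail_antimono[of x "\<bar>x\<bar>"] by linarith
qed

text \<open>
  The function \<open>t^3 p1 t\<close> has derivative \<open>- (t^6/3 - 3 t^2) p1 t\<close>, and for \<open>t \<ge> 2\<close> the first term
  dominates the second.
\<close>

lemma p1_sixth_moment_tail:
  assumes x: "2 \<le> x" shows "(LBINT t:{x..}. t^6 * p1 t) \<le> 7 * x^3 * p1 x"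
proof -
  define f where "f = (\<lambda>t. (t^6 / 3 - 3 * t\<^sup>2) * p1 t)"
  have dom: "t^6 \<le> 7 * (t^6 / 3 - 3 * t\<^sup>2)" if "2 \<le> t" for t :: real
  proof -
    have "2^4 * t\<^sup>2 \<le> t^4 * t\<^sup>2" using that by (intro mult_right_mono power_mono) auto
    then have "16 * t\<^sup>2 \<le> t^6" by (simp flip: power_add)
    moreover have "0 \<le> t\<^sup>2" by simp
    ultimately have "t^6 \<le> 7/3 * t^6 - 21 * t\<^sup>2" by linarith
    then show ?thesis by simp
  qed
  have nn: "0 \<le> f t" if "2 \<le> t" for t
  proof -
    have "0 \<le> t^6" by simp
    then have "0 \<le> 7 * (t^6 / 3 - 3 * t\<^sup>2)" using dom[OF that] by (rule order_trans)
    then show ?thesis using p1_pos[of t] by (simp add: f_def)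
  qed
  have int: "integrable lborel f"
    using Bochner_Integration.integrable_diff[OF integrable_divide[OF integrable_p1_moment[of 6], of 3] integrable_mult_right[OF integrable_p1_moment[of 2], of 3]]
    by (simp add: f_def algebra_simps)
  have "(\<integral>\<^sup>+t. ennreal (f t) * indicator {x..} t \<partial>lborel) = 0 - (- (x^3 * p1 x))"
  proof (rule nn_integral_FTC_atLeast)
    show "f \<in> borel_measurable borel" unfolding f_def by measurable
    show "((\<lambda>t. - (t^3 * p1 t)) has_real_derivative f t) (at t)" for t
      unfolding p1_def f_def by (auto intro!: derivative_eq_intros simp: field_simps numeral_eq_Suc)
    show "((\<lambda>t. - (t^3 * p1 t)) \<longlongrightarrow> 0) at_top" unfolding p1_def by real_asymp
  qed (use x nn in auto)
  also have "(\<integral>\<^sup>+t. ennreal (f t) * indicator {x..} t \<partial>lborel) = (\<integral>\<^sup>+t. ennreal (indicator {x..} t * f t) \<partial>lborel)"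
    by (intro nn_integral_cong) (auto simp: indicator_def)
  also have "\<dots> = ennreal (LBINT t. indicator {x..} t * f t)"
    using nn x by (intro nn_integral_eq_integral integrable_tail int) (auto simp: indicator_def)
  finally have F: "(LBINT t. indicator {x..} t * f t) = x^3 * p1 x"
    using nn x p1_pos[of x] by (subst (asm) ennreal_inj) (auto intro!: Bochner_Integration.integral_nonneg simp: indicator_def)
  have "(LBINT t:{x..}. t^6 * p1 t) \<le> (LBINT t. 7 * (indicator {x..} t * f t))"
    unfolding set_lebesgue_integral_def real_scaleR_def
  proof (rule integral_mono)
    show "indicator {x..} t * (t^6 * p1 t) \<le> 7 * (indicator {x..} t * f t)" for t
    proof (cases "x \<le> t")
      case True
      then have "t^6 * p1 t \<le> 7 * (t^6 / 3 - 3 * t\<^sup>2) * p1 t"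
        using x p1_pos[of t] by (intro mult_right_mono dom) auto
      then show ?thesis using True by (simp only: f_def mult.assoc indicator_simps atLeast_iff mult_1)
    qed simp
  qed (intro integrable_mult_right integrable_tail integrable_p1_moment int)+
  then show ?thesis using F by simp
qed

text \<open>
  For \<open>x \<ge> 2\<close> the sixth moment of the tail is \<open>O(x^3 p1 x)\<close>, and \<open>p1 x\<close> is \<open>O(1 + x^3)\<close> times the tail.
  For \<open>x \<le> 2\<close> the tail is bounded below by the tail at \<open>2\<close>.
\<close>

lemma p1_weighted_tail_bound:
  obtains K where "0 < K" "\<And>x. 0 \<le> x \<Longrightarrow> (LBINT t:{x..}. (1 + t^6) * p1 t) \<le> K * (1 + x^6) * p1_tail x"
proof -
  define M where "M = (LBINT t. (1 + t^6) * p1 t)"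
  define K where "K = M / p1_tail 2 + (1 + 14 * exp (5/4))"
  have M: "0 \<le> M" unfolding M_def
    by (intro Bochner_Integration.integral_nonneg mult_nonneg_nonneg less_imp_le[OF p1_pos]) simp
  have small: "(LBINT t:{x..}. (1 + t^6) * p1 t) \<le> K * (1 + x^6) * p1_tail x" if x: "0 \<le> x" "x \<le> 2" for x
  proof -
    have "(LBINT t:{x..}. (1 + t^6) * p1 t) \<le> M"
      unfolding M_def set_lebesgue_integral_def real_scaleR_def
      by (rule integral_mono; (intro integrable_tail integrable_weighted_p1)?)
         (auto simp: indicator_def intro!: mult_nonneg_nonneg less_imp_le[OF p1_pos])
    also have "\<dots> = M / p1_tail 2 * 1 * p1_tail 2" using p1_tail_pos[of 2] by simp
    also have "\<dots> \<le> K * (1 + x^6) * p1_tail x"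
      using M p1_tail_pos[of 2] x by (intro mult_mono p1_tail_antimono) (auto simp: K_def)
    finally show ?thesis .
  qed
  have large: "(LBINT t:{x..}. (1 + t^6) * p1 t) \<le> K * (1 + x^6) * p1_tail x" if x: "2 \<le> x" for x
  proof -
    have "(LBINT t:{x..}. (1 + t^6) * p1 t) = p1_tail x + (LBINT t:{x..}. t^6 * p1 t)"
      using Bochner_Integration.integral_add[OF integrable_tail[OF integrable_p1, of x] integrable_tail[OF integrable_p1_moment[of 6], of x]]
      by (simp add: p1_tail_def set_lebesgue_integral_def algebra_simps)
    also have "\<dots> \<le> p1_tail x + 7 * x^3 * (exp (5/4) * (1 + x^3) * p1_tail x)"
    proof -
      have "7 * x^3 * p1 x \<le> 7 * x^3 * (exp (5/4) * (1 + x^3) * p1_tail x)"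
        using x by (intro mult_left_mono p1_le_p1_tail) auto
      then show ?thesis using p1_sixth_moment_tail[OF x] by linarith
    qed
    also have "\<dots> = (1 + 7 * exp (5/4) * (x^3 * (1 + x^3))) * p1_tail x" by (simp add: algebra_simps)
    also have "\<dots> \<le> ((1 + 14 * exp (5/4)) * (1 + x^6)) * p1_tail x"
    proof (intro mult_right_mono)
      have "0 \<le> (x^3 - 1)\<^sup>2" by simp
      then have "2 * x^3 \<le> 1 + x^6" by (simp add: power2_diff flip: power_mult)
      moreover have "0 \<le> x^3" using x by simp
      ultimately have "x^3 + x^6 \<le> 2 + 2 * x^6" by linarith
      then have "x^3 * (1 + x^3) \<le> 2 * (1 + x^6)" by (simp add: distrib_left flip: power_add)
      then have "7 * exp (5/4) * (x^3 * (1 + x^3)) \<le> 7 * exp (5/4) * (2 * (1 + x^6))"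
        by (intro mult_left_mono) auto
      moreover have "(1 + 14 * exp (5/4)) * (1 + x^6) = 1 + x^6 + 7 * exp (5/4) * (2 * (1 + x^6))"
        by (simp add: algebra_simps)
      moreover have "0 \<le> x^6" by simp
      ultimately show "1 + 7 * exp (5/4) * (x^3 * (1 + x^3)) \<le> (1 + 14 * exp (5/4)) * (1 + x^6)"
        by linarith
    qed (use p1_tail_pos[of x] in simp)
    also have "\<dots> \<le> (K * (1 + x^6)) * p1_tail x"
      using M p1_tail_pos[of x] p1_tail_pos[of 2] x by (intro mult_right_mono) (auto simp: K_def)
    finally show ?thesis .
  qed
  show thesis
  proof (rule that)
    show "0 < K" using M p1_tail_pos[of 2] by (auto simp: K_def intro!: add_nonneg_pos)
    show "(LBINT t:{x..}. (1 + t^6) * p1 t) \<le> K * (1 + x^6) * p1_tail x" if "0 \<le> x" for x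
      using small[of x] large[of x] that by linarith
  qed
qed

section \<open>Relative error of the tail\<close>

text \<open>
  Used to pass between \<open>x\<close> and the end of the nearest cell.
\<close>

lemma tail_integral_shift:
  fixes f :: "real \<Rightarrow> real"
  assumes f: "integrable lborel f" and \<eta>: "0 \<le> \<eta>" "\<bar>y - x\<bar> \<le> \<eta>"
    and c: "\<And>t. \<bar>t - x\<bar> \<le> \<eta> \<Longrightarrow> \<bar>f t\<bar> \<le> c"
  shows "\<bar>(LBINT t:{y..}. f t) - (LBINT t:{x..}. f t)\<bar> \<le> 2 * \<eta> * c"
proof -
  let ?d = "\<lambda>t. indicator {y..} t * f t - indicator {x..} t * f t"
  have c0: "0 \<le> c" using c[of x] \<eta> by simp
  have int: "integrable lborel ?d" by (intro Bochner_Integration.integrable_diff integrable_tail f)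
  have "(LBINT t:{y..}. f t) - (LBINT t:{x..}. f t) = (LBINT t. ?d t)"
    unfolding set_lebesgue_integral_def real_scaleR_def
    by (intro Bochner_Integration.integral_diff[symmetric] integrable_tail f)
  also have "\<bar>\<dots>\<bar> \<le> (LBINT t. \<bar>?d t\<bar>)" by (rule integral_abs_bound)
  also have "\<dots> \<le> (LBINT t. indicator {x - \<eta>..x + \<eta>} t * c)"
  proof (rule integral_mono)
    show "\<bar>?d t\<bar> \<le> indicator {x - \<eta>..x + \<eta>} t * c" for t
    proof (cases "\<bar>t - x\<bar> \<le> \<eta>")
      case True
      then have "indicator {x - \<eta>..x + \<eta>} t = (1::real)" by (auto simp: indicator_def abs_le_iff)
      then show ?thesis using c[OF True] c0 by (auto simp: indicator_def)
    next
      case False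
      then show ?thesis using \<eta> by (auto simp: indicator_def abs_le_iff)
    qed
  qed (use \<eta> int in \<open>auto intro!: integrable_mult_left integrable_real_indicator integrable_abs\<close>)
  also have "\<dots> = 2 * \<eta> * c" using \<eta> by simp
  finally show ?thesis .
qed

text \<open>
  By convexity of \<open>t^4\<close> the exponent of \<open>p1\<close> exceeds its value at \<open>x\<close> by at most \<open>\<eta> x^3 / 3\<close> within
  distance \<open>\<eta>\<close> of \<open>x\<close>.
\<close>

lemma p1_near:
  assumes x: "0 \<le> x" and t: "\<bar>t - x\<bar> \<le> \<eta>" and \<eta>: "\<eta> * x^3 \<le> 1"
  shows "p1 t \<le> exp 1 * p1 x"
proof -
  have "0 \<le> (t - x)\<^sup>2 * ((t + x)\<^sup>2 + 2 * x\<^sup>2)" by simp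
  also have "\<dots> = t^4 - x^4 + 4 * (x^3 * (x - t))" by algebra
  finally have "x^4 - t^4 \<le> 4 * (x^3 * (x - t))" by simp
  also have "x^3 * (x - t) \<le> x^3 * \<eta>" using x t by (intro mult_left_mono) auto
  also have "x^3 * \<eta> \<le> 1" using \<eta> by (simp add: mult.commute)
  finally have "- (t^4) / 12 \<le> 1 + - (x^4) / 12" by simp
  then show ?thesis unfolding p1_def exp_add[symmetric] by simp
qed

text \<open>
  The error relative to the tail has two contributions: integrating \<open>profile_close_p1\<close> over
  \<open>[x, \<infinity>)\<close> gives \<open>O(1 + x^6) / sqrt n\<close> by \<open>p1_weighted_tail_bound\<close>; moving the end point from \<open>x\<close> to \<open>y\<close>
  gives \<open>O(n^(-3/4) p1 x)\<close>, which \<open>p1_le_p1_tail\<close> turns into \<open>O(1 + x^3) / n^(3/4)\<close> times the tail. The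
  hypothesis \<open>x^3 \<le> n^(1/4)\<close> keeps \<open>profile n\<close> below a multiple of \<open>p1 x\<close> near \<open>x\<close>.
\<close>

lemma profile_tail_relative_error:
  obtains K where "0 < K"
    "\<And>n x y. \<lbrakk>1 \<le> n; 0 \<le> x; x^3 \<le> rt n; \<bar>y - x\<bar> \<le> 1 / rt n ^ 3\<rbrakk>
      \<Longrightarrow> \<bar>(LBINT t:{y..}. profile n t) - p1_tail x\<bar> \<le> K * (1 + x^6) / (rt n)\<^sup>2 * p1_tail x"
proof -
  obtain K where K: "0 < K" "\<And>x. 0 \<le> x \<Longrightarrow> (LBINT t:{x..}. (1 + t^6) * p1 t) \<le> K * (1 + x^6) * p1_tail x"
    using p1_weighted_tail_bound by blast
  define c :: real where "c = 10 * exp 25"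
  \<comment> \<open>Near \<open>x\<close> one has \<open>1 + t^6 \<le> 65 sqrt n\<close>, so \<open>c'\<close> bounds \<open>profile n t / p1 x\<close> there.\<close>
  define c' where "c' = (1 + 65 * c) * exp 1"
  define C where "C = c * K + 4 * c' * exp (5/4)"
  have c: "0 < c" by (simp add: c_def)
  then have c': "0 < c'" by (simp add: c'_def add_pos_pos)
  have "0 < C" using c c' K(1) by (simp add: C_def add_pos_pos)
  moreover have "\<bar>(LBINT t:{y..}. profile n t) - p1_tail x\<bar> \<le> C * (1 + x^6) / (rt n)\<^sup>2 * p1_tail x"
    if n: "1 \<le> n" and x: "0 \<le> x" "x^3 \<le> rt n" and y: "\<bar>y - x\<bar> \<le> 1 / rt n ^ 3" for n x y
  proof -
    define r where "r = rt n"
    have r: "1 \<le> r" using rt_powers(1)[OF n] by (simp add: r_def)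
    note close = profile_close_p1[OF n, folded r_def c_def]
    have tail: "\<bar>(LBINT t:{x..}. profile n t) - p1_tail x\<bar> \<le> c / r\<^sup>2 * (K * (1 + x^6) * p1_tail x)"
    proof -
      have "(LBINT t:{x..}. profile n t) - p1_tail x = (LBINT t. indicator {x..} t * profile n t - indicator {x..} t * p1 t)"
        unfolding set_lebesgue_integral_def real_scaleR_def p1_tail_def
        by (intro Bochner_Integration.integral_diff[symmetric] integrable_tail integrable_profile integrable_p1 n)
      also have "\<bar>\<dots>\<bar> \<le> (LBINT t. \<bar>indicator {x..} t * profile n t - indicator {x..} t * p1 t\<bar>)"
        by (rule integral_abs_bound)
      also have "\<dots> \<le> (LBINT t. c / r\<^sup>2 * (indicator {x..} t * ((1 + t^6) * p1 t)))"
      proof (rule integral_mono)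
        show "\<bar>indicator {x..} t * profile n t - indicator {x..} t * p1 t\<bar> \<le> c / r\<^sup>2 * (indicator {x..} t * ((1 + t^6) * p1 t))" for t
          using close[of t] by (simp add: indicator_def)
      qed (intro integrable_abs Bochner_Integration.integrable_diff integrable_mult_right integrable_tail
             integrable_profile integrable_p1 integrable_weighted_p1 n)+
      also have "\<dots> = c / r\<^sup>2 * (LBINT t:{x..}. (1 + t^6) * p1 t)"
        by (simp add: set_lebesgue_integral_def)
      also have "\<dots> \<le> c / r\<^sup>2 * (K * (1 + x^6) * p1_tail x)"
        using c by (intro mult_left_mono K x) auto
      finally show ?thesis .
    qed
    have "\<bar>(LBINT t:{y..}. profile n t) - (LBINT t:{x..}. profile n t)\<bar> \<le> 2 * (1 / r^3) * (c' * p1 x)"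
    proof (rule tail_integral_shift[OF integrable_profile[OF n]])
      show "\<bar>y - x\<bar> \<le> 1 / r^3" using y by (simp add: r_def)
      fix t assume t: "\<bar>t - x\<bar> \<le> 1 / r^3"
      have "1 / r^3 \<le> 1" using r by simp
      then have "\<bar>t\<bar> \<le> x + 1" using t x by linarith
      then have "\<bar>t\<bar>^6 \<le> (x + 1)^6" by (intro power_mono) auto
      also have "\<dots> = ((x + 1)^3)\<^sup>2" by (simp flip: power_mult)
      also have "\<dots> \<le> (8 * r)\<^sup>2"
      proof (rule power_mono)
        have "0 \<le> (x - 1)\<^sup>2 * (x + 1)" using x by simp
        then have "(x + 1)^3 \<le> 4 * (x^3 + 1)" by (simp add: power3_eq_cube power2_eq_square algebra_simps)
        then show "(x + 1)^3 \<le> 8 * r" using x r by (simp add: r_def)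
      qed (use x in simp)
      finally have "t^6 \<le> 64 * r\<^sup>2" by (simp add: power_mult_distrib)
      then have "1 + t^6 \<le> 65 * r\<^sup>2" using one_le_power[OF r, of 2] by linarith
      then have "c * (1 + t^6) / r\<^sup>2 \<le> c * (65 * r\<^sup>2) / r\<^sup>2"
        using c by (intro divide_right_mono mult_left_mono) auto
      also have "\<dots> = 65 * c" using r by simp
      finally have "c * (1 + t^6) / r\<^sup>2 * p1 t \<le> 65 * c * p1 t"
        using p1_pos[of t] by (intro mult_right_mono) auto
      then have "\<bar>profile n t\<bar> \<le> (1 + 65 * c) * p1 t"
        using close[of t] p1_pos[of t] by (simp add: distrib_right)
      also have "\<dots> \<le> (1 + 65 * c) * (exp 1 * p1 x)"
      proof (intro mult_left_mono p1_near[OF x(1) t])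
        have "x^3 \<le> r^3" using x(2) power_increasing[of 1 3 r] r by (simp add: r_def)
        then show "1 / r^3 * x^3 \<le> 1" using r by simp
      qed (use c in simp)
      finally show "\<bar>profile n t\<bar> \<le> c' * p1 x" by (simp add: c'_def)
    qed (use r in simp)
    also have "\<dots> \<le> 2 * (1 / r\<^sup>2) * (c' * (exp (5/4) * (1 + x^3) * p1_tail x))"
      using r c' p1_pos[of x] p1_tail_pos[of x] p1_le_p1_tail[OF x(1)]
      by (intro mult_mono divide_left_mono power_increasing) auto
    also have "\<dots> = 2 * c' * exp (5/4) / r\<^sup>2 * p1_tail x * (1 + x^3)" by simp
    also have "\<dots> \<le> 2 * c' * exp (5/4) / r\<^sup>2 * p1_tail x * (2 * (1 + x^6))"
    proof (intro mult_left_mono)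
      have "0 \<le> (x^3 - 1)\<^sup>2" by simp
      then have "2 * x^3 \<le> 1 + x^6" by (simp add: power2_diff flip: power_mult)
      moreover have "0 \<le> x^6" by simp
      ultimately have "1 + x^3 \<le> 2 + 2 * x^6" by linarith
      then show "1 + x^3 \<le> 2 * (1 + x^6)" by simp
    qed (use c' p1_tail_pos[of x] in simp)
    also have "\<dots> = 4 * c' * exp (5/4) * (1 + x^6) / r\<^sup>2 * p1_tail x"
      by (simp only: times_divide_eq_left times_divide_eq_right) (simp add: algebra_simps)
    finally have shift: "\<bar>(LBINT t:{y..}. profile n t) - (LBINT t:{x..}. profile n t)\<bar>
        \<le> 4 * c' * exp (5/4) * (1 + x^6) / r\<^sup>2 * p1_tail x" .
    have "\<bar>(LBINT t:{y..}. profile n t) - p1_tail x\<bar>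
      \<le> 4 * c' * exp (5/4) * (1 + x^6) / r\<^sup>2 * p1_tail x + c / r\<^sup>2 * (K * (1 + x^6) * p1_tail x)"
      using shift tail by linarith
    also have "\<dots> = C * (1 + x^6) / r\<^sup>2 * p1_tail x"
      using r by (simp add: C_def divide_simps) (simp add: algebra_simps)
    finally show ?thesis by (simp add: r_def)
  qed
  ultimately show thesis by (rule that)
qed

definition p1_mass :: real where "p1_mass = (LBINT t. p1 t)"

lemma p1_mass_pos: "0 < p1_mass"
proof -
  have "p1_tail 0 \<le> p1_mass"
    unfolding p1_mass_def p1_tail_def set_lebesgue_integral_def real_scaleR_def
    by (rule integral_mono; (intro integrable_tail integrable_p1)?)
       (auto simp: indicator_def intro!: mult_nonneg_nonneg less_imp_le[OF p1_pos])
  then show ?thesis using p1_tail_pos[of 0] by linarith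
qed

lemma one_minus_F: "1 - F x = p1_tail x / p1_mass"
proof -
  have "(LBINT t:{..x}. p1 t) + p1_tail x = (LBINT t. indicator {..x} t * p1 t + indicator {x..} t * p1 t)"
    unfolding set_lebesgue_integral_def p1_tail_def real_scaleR_def
    using integrable_mult_indicator[OF _ integrable_p1, of "{..x}"]
    by (intro Bochner_Integration.integral_add[symmetric] integrable_tail integrable_p1) simp_all
  also have "\<dots> = p1_mass"
    unfolding p1_mass_def
  proof (rule integral_cong_AE)
    show "AE t in lborel. indicator {..x} t * p1 t + indicator {x..} t * p1 t = p1 t"
      using AE_lborel_singleton[of x] by eventually_elim (auto simp: indicator_def)
  qed measurable
  finally have "(LBINT t:{..x}. p1 t) = p1_mass - p1_tail x" by simp
  then show ?thesis using p1_mass_pos by (simp add: F_def flip: p1_mass_def) (simp add: field_simps)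
qed

lemma profile_mass_error:
  obtains K where "0 < K" "\<And>n. 1 \<le> n \<Longrightarrow> \<bar>(LBINT t. profile n t) - p1_mass\<bar> \<le> K / (rt n)\<^sup>2"
proof -
  define K where "K = 10 * exp 25 * (LBINT t. (1 + t^6) * p1 t)"
  have "\<bar>(LBINT t. profile n t) - p1_mass\<bar> \<le> (K + 1) / (rt n)\<^sup>2" if n: "1 \<le> n" for n
  proof -
    have "(LBINT t. profile n t) - p1_mass = (LBINT t. profile n t - p1 t)"
      unfolding p1_mass_def by (intro Bochner_Integration.integral_diff[symmetric] integrable_profile integrable_p1 n)
    also have "\<bar>\<dots>\<bar> \<le> (LBINT t. \<bar>profile n t - p1 t\<bar>)" by (rule integral_abs_bound)
    also have "\<dots> \<le> (LBINT t. 10 * exp 25 / (rt n)\<^sup>2 * ((1 + t^6) * p1 t))"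
    proof (rule integral_mono)
      show "\<bar>profile n t - p1 t\<bar> \<le> 10 * exp 25 / (rt n)\<^sup>2 * ((1 + t^6) * p1 t)" for t
        using profile_close_p1[OF n, of t] by simp
    qed (intro integrable_abs Bochner_Integration.integrable_diff integrable_mult_right
           integrable_profile integrable_p1 integrable_weighted_p1 n)+
    also have "\<dots> = K / (rt n)\<^sup>2" by (simp add: K_def)
    also have "\<dots> \<le> (K + 1) / (rt n)\<^sup>2" by (intro divide_right_mono) auto
    finally show ?thesis .
  qed
  moreover have "0 \<le> K" unfolding K_def
    by (intro mult_nonneg_nonneg Bochner_Integration.integral_nonneg less_imp_le[OF p1_pos]) simp_all
  ultimately show thesis using that[of "K + 1"] by simp
qed

text \<open>
  For large \<open>n\<close> the mass is close to that of \<open>p1\<close>; for the remaining finitely many \<open>n\<close> the central cell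
  alone contributes \<open>2 / n^(3/4)\<close>.
\<close>

lemma profile_mass_bounded_below:
  obtains b where "0 < b" "\<And>n. 1 \<le> n \<Longrightarrow> b \<le> (LBINT t. profile n t)"
proof -
  obtain K where K: "0 < K" "\<And>n. 1 \<le> n \<Longrightarrow> \<bar>(LBINT t. profile n t) - p1_mass\<bar> \<le> K / (rt n)\<^sup>2"
    using profile_mass_error by blast
  \<comment> \<open>If \<open>sqrt n \<ge> q\<close> then the error \<open>K / sqrt n\<close> is at most half of \<open>p1_mass\<close>.\<close>
  define q where "q = 2 * K / p1_mass"
  have q: "0 < q" using K(1) p1_mass_pos by (simp add: q_def)
  define b where "b = min (p1_mass / 2) (2 / (q + 1)^2)"
  have "b \<le> (LBINT t. profile n t)" if n: "1 \<le> n" for n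
  proof (cases "q \<le> (rt n)\<^sup>2")
    case True
    moreover from this q have "0 < (rt n)\<^sup>2" by linarith
    ultimately have "K / (rt n)\<^sup>2 \<le> K / q" using K(1) q by (intro divide_left_mono mult_pos_pos) auto
    also have "\<dots> = p1_mass / 2" using K(1) p1_mass_pos by (simp add: q_def)
    finally have "p1_mass / 2 \<le> (LBINT t. profile n t)" using K(2)[OF n] by linarith
    then show ?thesis unfolding b_def by (rule min.coboundedI1)
  next
    case False
    have r: "1 \<le> rt n" using rt_powers(1)[OF n] .
    have "rt n ^ 3 \<le> rt n ^ 4" using r by (intro power_increasing) auto
    also have "\<dots> = ((rt n)\<^sup>2)\<^sup>2" by (simp flip: power_mult)
    also have "\<dots> \<le> (q + 1)\<^sup>2" using False by (intro power_mono) auto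
    finally have "2 / (q + 1)\<^sup>2 \<le> 2 / rt n ^ 3" using r q by (intro divide_left_mono) auto
    then have "2 / (q + 1)\<^sup>2 \<le> (LBINT t. profile n t)" using profile_integral_pos[OF n] by linarith
    then show ?thesis unfolding b_def by (rule min.coboundedI2)
  qed
  moreover have "0 < b" using q p1_mass_pos by (simp add: b_def)
  ultimately show thesis using that by blast
qed

text \<open>
  The tail and the mass of \<open>profile n\<close> both have relative error \<open>O(1 + x^6) / sqrt n\<close>, and so does their
  quotient because the mass is bounded below. The range of \<open>x\<close> is exactly \<open>x^3 \<le> n^(1/4)\<close>.
\<close>

lemma moderate_deviation_bound:
  "\<exists>C::real. C > 0 \<and> (\<forall>n::nat. \<forall>x::real. n \<ge> 1 \<longrightarrow> 0 \<le> x \<longrightarrow> x \<le> real n powr (1/12) \<longrightarrow>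
     \<bar>\<P>(\<sigma> in critical_curie_weiss n. scaled_magnetization n \<sigma> > x) / (1 - F x) - 1\<bar>
       \<le> C * (1 + x ^ 6) / sqrt (real n))"
proof -
  obtain K where K: "0 < K" "\<And>n x y. \<lbrakk>1 \<le> n; 0 \<le> x; x^3 \<le> rt n; \<bar>y - x\<bar> \<le> 1 / rt n ^ 3\<rbrakk>
      \<Longrightarrow> \<bar>(LBINT t:{y..}. profile n t) - p1_tail x\<bar> \<le> K * (1 + x^6) / (rt n)\<^sup>2 * p1_tail x"
    using profile_tail_relative_error by blast
  obtain L where L: "0 < L" "\<And>n. 1 \<le> n \<Longrightarrow> \<bar>(LBINT t. profile n t) - p1_mass\<bar> \<le> L / (rt n)\<^sup>2"
    using profile_mass_error by blast
  obtain b where b: "0 < b" "\<And>n. 1 \<le> n \<Longrightarrow> b \<le> (LBINT t. profile n t)"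
    using profile_mass_bounded_below by blast
  define C where "C = (K * p1_mass + L) / b"
  have "0 < C" using K(1) L(1) b(1) p1_mass_pos by (simp add: C_def add_pos_pos)
  moreover have "\<bar>\<P>(\<sigma> in critical_curie_weiss n. scaled_magnetization n \<sigma> > x) / (1 - F x) - 1\<bar>
       \<le> C * (1 + x ^ 6) / sqrt (real n)"
    if n: "1 \<le> n" and x: "0 \<le> x" "x \<le> real n powr (1/12)" for n x
  proof -
    define A B A' B' where "A = p1_tail x" and "B = p1_mass"
      and "A' = (LBINT t:{lattice_edge n x..}. profile n t)" and "B' = (LBINT t. profile n t)"
    define e where "e = (1 + x^6) / (rt n)\<^sup>2"
    have r: "1 \<le> rt n" using rt_powers(1)[OF n] .
    have pos: "0 < A" "0 < B" "b \<le> B'" "0 < B'"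
      using p1_tail_pos p1_mass_pos b(1) b(2)[OF n] by (auto simp: A_def B_def B'_def)
    have "x^3 \<le> (real n powr (1/12))^3" using x by (intro power_mono) auto
    then have "x^3 \<le> rt n" using n by (simp add: rt_def powr_power)
    then have 1: "\<bar>A' - A\<bar> \<le> K * e * A"
      using K(2)[OF n x(1) _ lattice_edge_near[OF n]] by (simp add: A_def A'_def e_def)
    have "L / (rt n)\<^sup>2 \<le> L * (1 + x^6) / (rt n)\<^sup>2" using L(1) by (intro divide_right_mono) auto
    then have 2: "\<bar>B' - B\<bar> \<le> L * e"
      using L(2)[OF n] by (simp add: B_def B'_def e_def)
    have "A' / B' / (A / B) - 1 = ((A' - A) * B - A * (B' - B)) / (B' * A)"
      using pos by (simp add: field_simps)
    also have "\<bar>\<dots>\<bar> = \<bar>(A' - A) * B - A * (B' - B)\<bar> / (B' * A)" using pos by simp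
    also have "\<dots> \<le> (K * e * A * B + A * (L * e)) / (B' * A)"
    proof (rule divide_right_mono)
      have "\<bar>(A' - A) * B - A * (B' - B)\<bar> \<le> \<bar>A' - A\<bar> * B + A * \<bar>B' - B\<bar>"
        using abs_triangle_ineq4[of "(A' - A) * B" "A * (B' - B)"] pos by (simp add: abs_mult)
      also have "\<dots> \<le> K * e * A * B + A * (L * e)" using 1 2 pos by (intro add_mono mult_right_mono mult_left_mono) auto
      finally show "\<bar>(A' - A) * B - A * (B' - B)\<bar> \<le> K * e * A * B + A * (L * e)" .
    qed (use pos in simp)
    also have "\<dots> = (K * B + L) * e / B'" using pos by (simp add: field_simps)
    also have "\<dots> \<le> (K * B + L) * e / b"
      using pos b(1) K(1) L(1) by (intro divide_left_mono mult_nonneg_nonneg) (auto simp: e_def)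
    also have "\<dots> = C * (1 + x^6) / sqrt (real n)"
      by (simp add: C_def e_def B_def rt_powers(3)[OF n])
    finally show ?thesis
      unfolding prob_tail_eq_profile_ratio[OF n] one_minus_F by (simp add: A_def B_def A'_def B'_def)
  qed
  ultimately show ?thesis by blast
qed

section \<open>First-order expansion of the distribution function\<close>

lemma profile_measurable [measurable]: "profile n \<in> borel_measurable borel"
  unfolding profile_def cell_def by measurable

text \<open>
  Dominated convergence with the pointwise limit \<open>profile_expansion\<close>; the bound \<open>profile_close_p1\<close>
  provides the majorant \<open>C (1 + t^6) p1 t\<close>. The moving domain \<open>S n\<close> serves both the tail, cut at the
  end of a cell, and the whole line.
\<close>

lemma scaled_difference_limit:
  fixes S :: "nat \<Rightarrow> real set"
  assumes S: "\<And>n. S n \<in> sets borel" "T \<in> sets borel"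
    and lim: "AE t in lborel. (\<lambda>n. indicator (S n) t :: real) \<longlonglongrightarrow> indicator T t"
  shows "(\<lambda>n. (rt n)\<^sup>2 * (LBINT t. indicator (S n) t * (profile n t - p1 t))) \<longlonglongrightarrow> (LBINT t. indicator T t * p2 t)"
proof (rule LIMSEQ_imp_Suc)
  have [measurable]: "S n \<in> sets borel" "T \<in> sets borel" for n using S by auto
  \<comment> \<open>The index is shifted because the majorant is available for \<open>n \<ge> 1\<close> only.\<close>
  have "(\<lambda>n. LBINT t. indicator (S (Suc n)) t * ((rt (Suc n))\<^sup>2 * (profile (Suc n) t - p1 t)))
    \<longlonglongrightarrow> (LBINT t. indicator T t * p2 t)"
  proof (rule integral_dominated_convergence[where w = "\<lambda>t. 10 * exp 25 * ((1 + t^6) * p1 t)"])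
    show "integrable lborel (\<lambda>t. 10 * exp 25 * ((1 + t^6) * p1 t))"
      by (intro integrable_mult_right integrable_weighted_p1)
    show "AE t in lborel. (\<lambda>n. indicator (S (Suc n)) t * ((rt (Suc n))\<^sup>2 * (profile (Suc n) t - p1 t))) \<longlonglongrightarrow> indicator T t * p2 t"
      using lim
    proof eventually_elim
      case (elim t)
      have "(\<lambda>n. indicator (S n) t * ((rt n)\<^sup>2 * (profile n t - p1 t))) \<longlonglongrightarrow> indicator T t * p2 t"
        by (intro tendsto_mult elim profile_expansion)
      then show ?case by (rule LIMSEQ_Suc)
    qed
    show "AE t in lborel. norm (indicator (S (Suc n)) t * ((rt (Suc n))\<^sup>2 * (profile (Suc n) t - p1 t))) \<le> 10 * exp 25 * ((1 + t^6) * p1 t)" for n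
    proof (rule AE_I2)
      fix t
      define R where "R = (rt (Suc n))\<^sup>2"
      have R: "0 < R" using rt_powers(1)[of "Suc n"] by (simp add: R_def)
      have "norm (indicator (S (Suc n)) t * (R * (profile (Suc n) t - p1 t))) \<le> R * \<bar>profile (Suc n) t - p1 t\<bar>"
        using R by (simp add: indicator_def abs_mult)
      also have "\<dots> \<le> R * (10 * exp 25 * (1 + t^6) / R * p1 t)"
        using profile_close_p1[of "Suc n" t] R by (intro mult_left_mono) (auto simp: R_def)
      also have "\<dots> = 10 * exp 25 * ((1 + t^6) * p1 t)" using R by simp
      finally show "norm (indicator (S (Suc n)) t * ((rt (Suc n))\<^sup>2 * (profile (Suc n) t - p1 t))) \<le> 10 * exp 25 * ((1 + t^6) * p1 t)"
        by (simp add: R_def)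
    qed
  qed measurable
  then show "(\<lambda>n. (rt (Suc n))\<^sup>2 * (LBINT t. indicator (S (Suc n)) t * (profile (Suc n) t - p1 t))) \<longlonglongrightarrow> (LBINT t. indicator T t * p2 t)"
    by (simp only: integral_mult_right_zero[symmetric] mult.left_commute)
qed

lemma profile_mass_expansion:
  "(\<lambda>n. (rt n)\<^sup>2 * ((LBINT t. profile n t) - p1_mass)) \<longlonglongrightarrow> (LBINT t. p2 t)"
proof -
  have "(\<lambda>n. (rt n)\<^sup>2 * (LBINT t. indicator UNIV t * (profile n t - p1 t))) \<longlonglongrightarrow> (LBINT t. indicator UNIV t * p2 t)"
    by (rule scaled_difference_limit) auto
  then have "(\<lambda>n. (rt n)\<^sup>2 * (LBINT t. indicator UNIV t * (profile n t - p1 t))) \<longlonglongrightarrow> (LBINT t. p2 t)"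
    by simp
  moreover have "eventually (\<lambda>n. (rt n)\<^sup>2 * (LBINT t. indicator UNIV t * (profile n t - p1 t))
      = (rt n)\<^sup>2 * ((LBINT t. profile n t) - p1_mass)) sequentially"
    using eventually_ge_at_top[of 1]
    by eventually_elim (simp add: p1_mass_def Bochner_Integration.integral_diff integrable_profile integrable_p1)
  ultimately show ?thesis by (rule Lim_transform_eventually)
qed

text \<open>
  The end of the cell differs from \<open>x\<close> by at most \<open>n^(-3/4)\<close>, so replacing one by the other changes
  the integral of \<open>p1\<close> by \<open>o(n^(-1/2))\<close> and the domain of the limit only in the null set \<open>{x}\<close>.
\<close>

lemma profile_tail_expansion:
  "(\<lambda>n. (rt n)\<^sup>2 * ((LBINT t:{lattice_edge n x..}. profile n t) - p1_tail x)) \<longlonglongrightarrow> (LBINT t:{x..}. p2 t)"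
proof -
  let ?e = "\<lambda>n. lattice_edge n x"
  have edge: "?e \<longlonglongrightarrow> x"
  proof -
    have "eventually (\<lambda>n. norm (?e n - x) \<le> 1 / rt n ^ Suc 2) sequentially"
      using eventually_ge_at_top[of 1] by eventually_elim (use lattice_edge_near in \<open>simp add: numeral_3_eq_3 numeral_2_eq_2\<close>)
    from Lim_null_comparison[OF this tendsto_divide_rt_power] show ?thesis by (simp add: LIM_zero_iff)
  qed
  have "(\<lambda>n. (rt n)\<^sup>2 * (LBINT t. indicator {?e n..} t * (profile n t - p1 t))) \<longlonglongrightarrow> (LBINT t. indicator {x..} t * p2 t)"
  proof (rule scaled_difference_limit)
    show "AE t in lborel. (\<lambda>n. indicator {?e n..} t :: real) \<longlonglongrightarrow> indicator {x..} t"
      using AE_lborel_singleton[of x]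
    proof eventually_elim
      case (elim t)
      then consider "t < x" | "x < t" by linarith
      then have "eventually (\<lambda>n. indicator {?e n..} t = (indicator {x..} t :: real)) sequentially"
      proof cases
        case 1
        from order_tendstoD(1)[OF edge this] show ?thesis
          by eventually_elim (use 1 in \<open>auto simp: indicator_def\<close>)
      next
        case 2
        from order_tendstoD(2)[OF edge this] show ?thesis
          by eventually_elim (use 2 in \<open>auto simp: indicator_def\<close>)
      qed
      then show ?case by (rule tendsto_eventually)
    qed
  qed auto
  moreover have "(\<lambda>n. (rt n)\<^sup>2 * (p1_tail (?e n) - p1_tail x)) \<longlonglongrightarrow> 0"
  proof (rule Lim_null_comparison)
    show "eventually (\<lambda>n. norm ((rt n)\<^sup>2 * (p1_tail (?e n) - p1_tail x)) \<le> 2 / rt n ^ Suc 0) sequentially"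
      using eventually_ge_at_top[of 1]
    proof eventually_elim
      case (elim n)
      then have r: "1 \<le> rt n" by (rule rt_powers)
      have "\<bar>p1_tail (?e n) - p1_tail x\<bar> \<le> 2 * (1 / rt n ^ 3) * 1"
        unfolding p1_tail_def
        by (rule tail_integral_shift[OF integrable_p1])
           (use r p1_le_1 p1_pos lattice_edge_near[OF elim] in \<open>auto simp: abs_of_pos\<close>)
      then have "(rt n)\<^sup>2 * \<bar>p1_tail (?e n) - p1_tail x\<bar> \<le> (rt n)\<^sup>2 * (2 * (1 / rt n ^ 3) * 1)"
        by (intro mult_left_mono) auto
      also have "\<dots> = 2 / rt n ^ Suc 0" using r by (simp add: field_simps numeral_eq_Suc)
      finally show ?case by (simp add: abs_mult)
    qed
  qed (rule tendsto_divide_rt_power)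
  ultimately have "(\<lambda>n. (rt n)\<^sup>2 * (LBINT t. indicator {?e n..} t * (profile n t - p1 t)) + (rt n)\<^sup>2 * (p1_tail (?e n) - p1_tail x))
      \<longlonglongrightarrow> (LBINT t:{x..}. p2 t)"
    unfolding set_lebesgue_integral_def real_scaleR_def by (rule tendsto_add[where b = 0, simplified add_0_right])
  moreover have "eventually (\<lambda>n. (rt n)\<^sup>2 * (LBINT t. indicator {?e n..} t * (profile n t - p1 t)) + (rt n)\<^sup>2 * (p1_tail (?e n) - p1_tail x)
      = (rt n)\<^sup>2 * ((LBINT t:{?e n..}. profile n t) - p1_tail x)) sequentially"
    using eventually_ge_at_top[of 1]
  proof eventually_elim
    case (elim n)
    have "(LBINT t. indicator {?e n..} t * (profile n t - p1 t)) = (LBINT t:{?e n..}. profile n t) - p1_tail (?e n)"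
      unfolding set_lebesgue_integral_def real_scaleR_def p1_tail_def right_diff_distrib
      by (intro Bochner_Integration.integral_diff integrable_tail integrable_profile integrable_p1 elim)
    then show ?case by (simp only: distrib_left[symmetric]) simp
  qed
  ultimately show ?thesis by (rule Lim_transform_eventually)
qed

text \<open>
  The quotient rule: if the tail \<open>A'\<close> and the mass \<open>B'\<close> are \<open>A + a / sqrt n\<close> and \<open>B + Q / sqrt n\<close> to first
  order, then \<open>A / B - A' / B'\<close> is \<open>(A Q - a B) / (B^2 sqrt n)\<close>.
\<close>

lemma cdf_expansion:
  "(\<lambda>n::nat. sqrt (real n) * (\<P>(\<sigma> in critical_curie_weiss n. scaled_magnetization n \<sigma> \<le> x) - F x))
     \<longlonglongrightarrow> (F x - 1) * G x"
proof -
  define A B a Q where "A = p1_tail x" and "B = p1_mass" and "a = (LBINT t:{x..}. p2 t)" and "Q = (LBINT t. p2 t)"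
  define A' B' where "A' = (\<lambda>n. LBINT t:{lattice_edge n x..}. profile n t)" and "B' = (\<lambda>n. LBINT t. profile n t)"
  have pos: "0 < A" "0 < B" using p1_tail_pos p1_mass_pos by (auto simp: A_def B_def)
  have FG: "(F x - 1) * G x = (A * Q - a * B) / (B * B)"
  proof -
    have "F x - 1 = - (A / B)" using one_minus_F[of x] by (simp add: A_def B_def)
    moreover have "G x = a / A - Q / B"
      by (simp add: G_def A_def B_def a_def Q_def p1_tail_def p1_mass_def)
    ultimately have "(F x - 1) * G x = - (A / B) * (a / A - Q / B)" by simp
    also have "\<dots> = (A * Q - a * B) / (B * B)" using pos by (simp add: field_simps)
    finally show ?thesis .
  qed
  have dA: "(\<lambda>n. (rt n)\<^sup>2 * (A' n - A)) \<longlonglongrightarrow> a" unfolding A'_def A_def a_def by (rule profile_tail_expansion)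
  have dB: "(\<lambda>n. (rt n)\<^sup>2 * (B' n - B)) \<longlonglongrightarrow> Q" unfolding B'_def B_def Q_def by (rule profile_mass_expansion)
  have B': "B' \<longlonglongrightarrow> B"
  proof -
    have "filterlim (\<lambda>n. (rt n)\<^sup>2) at_top sequentially" by (intro filterlim_pow_at_top rt_at_top) simp
    from real_tendsto_divide_at_top[OF dB this]
    have "(\<lambda>n. (rt n)\<^sup>2 * (B' n - B) / (rt n)\<^sup>2) \<longlonglongrightarrow> 0" .
    moreover have "eventually (\<lambda>n. (rt n)\<^sup>2 * (B' n - B) / (rt n)\<^sup>2 = B' n - B) sequentially"
      using eventually_ge_at_top[of 1]
    proof eventually_elim
      case (elim n)
      then have "1 \<le> rt n" by (rule rt_powers)
      then show ?case by simp
    qed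
    ultimately have "(\<lambda>n. B' n - B) \<longlonglongrightarrow> 0" by (rule Lim_transform_eventually)
    then show ?thesis by (simp add: LIM_zero_iff)
  qed
  have "(\<lambda>n. (A * ((rt n)\<^sup>2 * (B' n - B)) - (rt n)\<^sup>2 * (A' n - A) * B) / (B * B' n)) \<longlonglongrightarrow> (A * Q - a * B) / (B * B)"
    using pos by (intro tendsto_intros dA dB B') auto
  moreover have "eventually (\<lambda>n. (A * ((rt n)\<^sup>2 * (B' n - B)) - (rt n)\<^sup>2 * (A' n - A) * B) / (B * B' n)
    = sqrt (real n) * (\<P>(\<sigma> in critical_curie_weiss n. scaled_magnetization n \<sigma> \<le> x) - F x)) sequentially"
    using eventually_ge_at_top[of 1]
  proof eventually_elim
    case (elim n)
    interpret prob_space "critical_curie_weiss n" by (rule prob_space_curie_weiss)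
    have sets: "sets (critical_curie_weiss n) = Pow (space (critical_curie_weiss n))"
      by (simp add: curie_weiss_def sets_point_measure space_point_measure)
    have "{\<sigma> \<in> space (critical_curie_weiss n). scaled_magnetization n \<sigma> \<le> x}
        = space (critical_curie_weiss n) - {\<sigma> \<in> space (critical_curie_weiss n). scaled_magnetization n \<sigma> > x}" by auto
    then have "\<P>(\<sigma> in critical_curie_weiss n. scaled_magnetization n \<sigma> \<le> x)
        = 1 - \<P>(\<sigma> in critical_curie_weiss n. scaled_magnetization n \<sigma> > x)"
      by (simp add: prob_compl sets)
    also have "\<dots> = 1 - A' n / B' n" by (simp add: prob_tail_eq_profile_ratio[OF elim] A'_def B'_def)
    finally have diff: "\<P>(\<sigma> in critical_curie_weiss n. scaled_magnetization n \<sigma> \<le> x) - F x = A / B - A' n / B' n"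
      using one_minus_F[of x] by (simp add: A_def B_def)
    have "0 < B' n"
    proof -
      have "0 < 2 / rt n ^ 3" using rt_powers(1)[OF elim] by simp
      then show ?thesis using profile_integral_pos[OF elim] unfolding B'_def by linarith
    qed
    then show ?case using pos unfolding diff rt_powers(3)[OF elim] by (simp add: field_simps)
  qed
  ultimately show ?thesis unfolding FG by (rule Lim_transform_eventually)
qed

theorem corollary1p5:
  shows "(\<exists>C::real. C > 0 \<and>
           (\<forall>n::nat. \<forall>x::real. n \<ge> 1 \<longrightarrow> 0 \<le> x \<longrightarrow> x \<le> real n powr (1/12) \<longrightarrow>
              \<bar>\<P>(\<sigma> in critical_curie_weiss n. scaled_magnetization n \<sigma> > x) / (1 - F x) - 1\<bar>
                \<le> C * (1 + x ^ 6) / sqrt (real n)))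
       \<and> (\<forall>x::real.
            (\<lambda>n::nat. sqrt (real n) *
               (\<P>(\<sigma> in critical_curie_weiss n. scaled_magnetization n \<sigma> \<le> x) - F x))
            \<longlonglongrightarrow> (F x - 1) * G x)"
  using moderate_deviation_bound cdf_expansion by blast

end
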